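(* For each integer $m\ge 1$ there is a positive integer $t^*(m)$ such that the following holds: whenever $t\ge t^*(m)$ and $d_{\mathrm{plan}}$ is a uniform balanced repeated measurements design (UBRMD) with $t$ treatments, $t$ time periods and $s=gt$ subjects ($g$ a positive integer), the design $d_{\min}$ consisting of the first $t-m$ periods of $d_{\mathrm{plan}}$ is connected for direct treatment effects. In particular, for $m=1$, $d_{\min}$ is connected whenever $t\ge5$; for $m=2$, $d_{\min}$ is connected whenever $t\ge 8$.
   Context: A (crossover) design with $p$ periods, $s$ subjects and $t$ treatments labelled $0,\dots,t-1$ assigns a treatment $d(k,i)$ to each subject $i\in\{1,\dots,s\}$ in each period $k\in\{1,\dots,p\}$. It is uniform if each subject receives every treatment in the same number of periods and in each period every treatment is given to the same number of subjects. It is balanced if, in the order of application, each treatment is immediately preceded by every other treatment the same number of times and is never immediately preceded by itself. A UBRMD with $t$ treatments, $t$ periods and $s=gt$ subjects is a uniform and balanced such design (so each subject receives each treatment exactly once, and each treatment appears $g$ times in each period). Model: $Y=X_S\beta+X_P\alpha+X_D\tau+X_C\rho+\epsilon$, with fixed subject, period, direct treatment and carry-over effects. With rows indexed by (subject $i$, period $k$): $X_S=I_s\otimes\mathbf 1_p$, $X_P=\mathbf 1_s\otimes I_p$; the row of $X_D$ for $(i,k)$ has a $1$ in the column of treatment $d(k,i)$ and $0$ elsewhere; the row of $X_C$ for $(i,k)$ has a $1$ in the column of treatment $d(k-1,i)$ and $0$ elsewhere if $k\ge2$, and is zero if $k=1$. Put $N_{ab}=X_a'X_b$ for $a,b\in\{S,P,D,C\}$,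 $r_D=N_{DS}\mathbf 1_s$, $r_C=N_{CS}\mathbf 1_s$, $r_D^\delta=\mathrm{diag}(r_D)$, $r_C^\delta=\mathrm{diag}(r_C)$, and $C_{11}=r_D^\delta+\frac1{ps}r_Dr_D'-\frac1pN_{DS}N_{SD}-\frac1sN_{DP}N_{PD}$, $C_{22}=r_C^\delta+\frac1{ps}r_Cr_C'-\frac1pN_{CS}N_{SC}-\frac1sN_{CP}N_{PC}$, $C_{12}=N_{DC}+\frac1{ps}r_Dr_C'-\frac1pN_{DS}N_{SC}-\frac1sN_{DP}N_{PC}$, $C_{21}=C_{12}'$. The direct-effects information matrix of the design $d$ is $C_D^d=C_{11}-C_{12}C_{22}^{-}C_{21}$, where $M^-$ is any generalized inverse ($MM^-M=M$). For $d_{\min}$ these are computed with $p=t-m$, $s=gt$. A design $d$ is connected (for direct treatment effects) if all elementary contrasts $\tau_i-\tau_j$ are estimable, equivalently $\operatorname{rank} C_D^d=t-1$. Here $'$ is transpose and $\mathbf 1_a$ is the all-ones vector of length $a$. Standing assumption: $1\le m<t-1$. *)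

theory Defs
  imports Jordan_Normal_Form.DL_Rank
begin

text \<open>
  Periods and subjects are numbered from 1 and treatments from 0; \<open>d k i\<close> is the treatment
  given to subject \<open>i\<close> in period \<open>k\<close>. Only the values with \<open>k\<close> in \<open>{1..p}\<close> and \<open>i\<close> in
  \<open>{1..s}\<close> matter, so the design consisting of the first \<open>q\<close> periods of \<open>d\<close> is \<open>d\<close> itself
  with \<open>q\<close> in place of \<open>p\<close> as its number of periods.
\<close>

type_synonym design = "nat \<Rightarrow> nat \<Rightarrow> nat"

definition crossover_design :: "nat \<Rightarrow> nat \<Rightarrow> nat \<Rightarrow> design \<Rightarrow> bool" where
  "crossover_design p s t d \<longleftrightarrow> (\<forall>k\<in>{1..p}. \<forall>i\<in>{1..s}. d k i < t)"

definition uniform_design :: "nat \<Rightarrow> nat \<Rightarrow> nat \<Rightarrow> design \<Rightarrow> bool" where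
  "uniform_design p s t d \<longleftrightarrow>
     (\<forall>i\<in>{1..s}. \<forall>a<t. \<forall>b<t. card {k\<in>{1..p}. d k i = a} = card {k\<in>{1..p}. d k i = b}) \<and>
     (\<forall>k\<in>{1..p}. \<forall>a<t. \<forall>b<t. card {i\<in>{1..s}. d k i = a} = card {i\<in>{1..s}. d k i = b})"

text \<open>Number of times that treatment \<open>a\<close> is immediately preceded by treatment \<open>b\<close>.\<close>

definition preceded_count :: "nat \<Rightarrow> nat \<Rightarrow> design \<Rightarrow> nat \<Rightarrow> nat \<Rightarrow> nat" where
  "preceded_count p s d a b =
     card {(k, i). k \<in> {2..p} \<and> i \<in> {1..s} \<and> d k i = a \<and> d (k - 1) i = b}"

definition balanced_design :: "nat \<Rightarrow> nat \<Rightarrow> nat \<Rightarrow> design \<Rightarrow> bool" where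
  "balanced_design p s t d \<longleftrightarrow>
     (\<exists>l. \<forall>a<t. \<forall>b<t. a \<noteq> b \<longrightarrow> preceded_count p s d a b = l) \<and>
     (\<forall>a<t. preceded_count p s d a a = 0)"

definition ubrmd :: "nat \<Rightarrow> nat \<Rightarrow> design \<Rightarrow> bool" where
  "ubrmd g t d \<longleftrightarrow>
     crossover_design t (g * t) t d \<and> uniform_design t (g * t) t d \<and> balanced_design t (g * t) t d"

text \<open>
  Matrix rows and columns are indexed from 0. Row \<open>r < s * p\<close> belongs to subject
  \<open>r div p + 1\<close> and period \<open>r mod p + 1\<close>; this is the row order of the Kronecker products
  \<open>X\<^sub>S = I\<^sub>s \<otimes> 1\<^sub>p\<close> and \<open>X\<^sub>P = 1\<^sub>s \<otimes> I\<^sub>p\<close>.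
\<close>

definition X_S :: "nat \<Rightarrow> nat \<Rightarrow> real mat" where
  "X_S p s = mat (s * p) s (\<lambda>(r, i). if r div p = i then 1 else 0)"

definition X_P :: "nat \<Rightarrow> nat \<Rightarrow> real mat" where
  "X_P p s = mat (s * p) p (\<lambda>(r, k). if r mod p = k then 1 else 0)"

definition X_D :: "nat \<Rightarrow> nat \<Rightarrow> nat \<Rightarrow> design \<Rightarrow> real mat" where
  "X_D p s t d =
     mat (s * p) t (\<lambda>(r, a). if d (r mod p + 1) (r div p + 1) = a then 1 else 0)"

text \<open>The period preceding that of row \<open>r\<close> is \<open>r mod p\<close>, provided \<open>r mod p \<noteq> 0\<close>.\<close>

definition X_C :: "nat \<Rightarrow> nat \<Rightarrow> nat \<Rightarrow> design \<Rightarrow> real mat" where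
  "X_C p s t d =
     mat (s * p) t (\<lambda>(r, a). if r mod p \<noteq> 0 \<and> d (r mod p) (r div p + 1) = a then 1 else 0)"

text \<open>
  For \<open>A = X\<^sub>a\<close> and \<open>B = X\<^sub>b\<close> with \<open>a, b \<in> {D, C}\<close>, \<open>info_block p s L A B\<close> is
  \<open>N\<^sub>a\<^sub>b + (1/ps) r\<^sub>a r\<^sub>b' - (1/p) N\<^sub>a\<^sub>S N\<^sub>S\<^sub>b - (1/s) N\<^sub>a\<^sub>P N\<^sub>P\<^sub>b\<close>
  when \<open>L = N\<^sub>a\<^sub>b\<close>. The leading term is a parameter because it is written as \<open>r\<^sub>a\<^sup>\<delta>\<close> in the
  diagonal blocks.
\<close>

definition repl :: "nat \<Rightarrow> nat \<Rightarrow> real mat \<Rightarrow> real vec" where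
  "repl p s A = (A\<^sup>T * X_S p s) *\<^sub>v vec s (\<lambda>_. 1)"

definition repl_diag :: "nat \<Rightarrow> nat \<Rightarrow> real mat \<Rightarrow> real mat" where
  "repl_diag p s A = mat_diag (dim_col A) (\<lambda>a. repl p s A $ a)"

definition info_block :: "nat \<Rightarrow> nat \<Rightarrow> real mat \<Rightarrow> real mat \<Rightarrow> real mat \<Rightarrow> real mat" where
  "info_block p s L A B =
     L + (1 / (real p * real s)) \<cdot>\<^sub>m
           mat (dim_col A) (dim_col B) (\<lambda>(a, b). repl p s A $ a * repl p s B $ b)
       - (1 / real p) \<cdot>\<^sub>m ((A\<^sup>T * X_S p s) * ((X_S p s)\<^sup>T * B))
       - (1 / real s) \<cdot>\<^sub>m ((A\<^sup>T * X_P p s) * ((X_P p s)\<^sup>T * B))"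

definition C11 :: "nat \<Rightarrow> nat \<Rightarrow> nat \<Rightarrow> design \<Rightarrow> real mat" where
  "C11 p s t d = info_block p s (repl_diag p s (X_D p s t d)) (X_D p s t d) (X_D p s t d)"

definition C22 :: "nat \<Rightarrow> nat \<Rightarrow> nat \<Rightarrow> design \<Rightarrow> real mat" where
  "C22 p s t d = info_block p s (repl_diag p s (X_C p s t d)) (X_C p s t d) (X_C p s t d)"

definition C12 :: "nat \<Rightarrow> nat \<Rightarrow> nat \<Rightarrow> design \<Rightarrow> real mat" where
  "C12 p s t d =
     info_block p s ((X_D p s t d)\<^sup>T * X_C p s t d) (X_D p s t d) (X_C p s t d)"

definition C21 :: "nat \<Rightarrow> nat \<Rightarrow> nat \<Rightarrow> design \<Rightarrow> real mat" where
  "C21 p s t d = (C12 p s t d)\<^sup>T"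

definition generalized_inverse :: "real mat \<Rightarrow> real mat \<Rightarrow> bool" where
  "generalized_inverse M G \<longleftrightarrow> G \<in> carrier_mat (dim_col M) (dim_row M) \<and> M * G * M = M"

text \<open>\<open>G\<close> stands for the generalized inverse of \<open>C22 p s t d\<close> that is used.\<close>

definition C_D :: "nat \<Rightarrow> nat \<Rightarrow> nat \<Rightarrow> design \<Rightarrow> real mat \<Rightarrow> real mat" where
  "C_D p s t d G = C11 p s t d - C12 p s t d * G * C21 p s t d"

definition mean_response ::
  "nat \<Rightarrow> nat \<Rightarrow> nat \<Rightarrow> design \<Rightarrow> real vec \<Rightarrow> real vec \<Rightarrow> real vec \<Rightarrow> real vec \<Rightarrow> real vec" where
  "mean_response p s t d \<beta> \<alpha> \<tau> \<rho> =
     X_S p s *\<^sub>v \<beta> + X_P p s *\<^sub>v \<alpha> + X_D p s t d *\<^sub>v \<tau> + X_C p s t d *\<^sub>v \<rho>"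

text \<open>
  A contrast is estimable if it has a linear unbiased estimator \<open>w \<bullet> Y\<close>; since the errors have
  mean zero, the expectation of \<open>w \<bullet> Y\<close> is \<open>w \<bullet> mean_response p s t d \<beta> \<alpha> \<tau> \<rho>\<close>.
\<close>

definition contrast_estimable :: "nat \<Rightarrow> nat \<Rightarrow> nat \<Rightarrow> design \<Rightarrow> nat \<Rightarrow> nat \<Rightarrow> bool" where
  "contrast_estimable p s t d i j \<longleftrightarrow>
     (\<exists>w\<in>carrier_vec (s * p).
        \<forall>\<beta>\<in>carrier_vec s. \<forall>\<alpha>\<in>carrier_vec p. \<forall>\<tau>\<in>carrier_vec t. \<forall>\<rho>\<in>carrier_vec t.
          w \<bullet> mean_response p s t d \<beta> \<alpha> \<tau> \<rho> = \<tau> $ i - \<tau> $ j)"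

text \<open>
  Estimability of all elementary contrasts and the rank condition on the information matrix
  (for every choice of the generalized inverse) are the two classically equivalent forms of
  connectedness; both are required here, so that the definition does not rest on their equivalence.
\<close>

definition connected_direct :: "nat \<Rightarrow> nat \<Rightarrow> nat \<Rightarrow> design \<Rightarrow> bool" where
  "connected_direct p s t d \<longleftrightarrow>
     (\<forall>i<t. \<forall>j<t. contrast_estimable p s t d i j) \<and>
     (\<forall>G. generalized_inverse (C22 p s t d) G \<longrightarrow> vec_space.rank t (C_D p s t d G) = t - 1)"

end

theory Submission
  imports Defs "HOL-Analysis.L2_Norm"
begin

text \<open>
  Since \<open>C\<^sub>D\<close> is the Schur complement in the Gram matrix of the columns of \<open>X\<^sub>D\<close> and \<open>X\<^sub>C\<close> after
  projecting out subjects and periods, both forms of connectedness follow once every parameter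
  vector with zero mean response has constant \<open>\<tau>\<close>.

  Let \<open>p = t - m\<close>, suppose the mean response vanishes, and centre \<open>\<tau>\<close> and \<open>\<rho>\<close> to have sum zero.
  Summing over the subjects shows that the period effects are constant, so
  \<open>z k i = \<tau> (d k i) + \<rho> (d (k - 1) i)\<close> (without the second term if \<open>k = 1\<close>) does not depend on \<open>k\<close>,
  and \<open>p * (\<Sum>k i. (z k i)\<^sup>2) = (\<Sum>i. (\<Sum>k. z k i)\<^sup>2)\<close>. In the full design all the sums
  involved are known; the deleted \<open>m\<close> periods are estimated by the inequalities of Cauchy-Schwarz and
  Minkowski. With \<open>x = \<parallel>\<tau>\<parallel>\<close> and \<open>y = \<parallel>\<rho>\<parallel>\<close> this gives
  \<open>p x\<^sup>2 + (p - 1) y\<^sup>2 - 2 (m + 1) x y \<le> (m x + (m + 1) y)\<^sup>2 / p\<close>,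
  which forces \<open>x = 0\<close> if \<open>m = 1, p \<ge> 4\<close>, if \<open>m = 2, p \<ge> 6\<close>, and always if \<open>p \<ge> 3 (m + 1)\<close>.
\<close>

section \<open>Sums over the full design\<close>

text \<open>Uniformity and balance are statements about fibre sizes; grouping the terms by the value
  of \<open>\<phi>\<close> turns sums over periods, subjects or transitions into such
  counts.\<close>

lemma sum_comp_card:
  fixes F :: "'b \<Rightarrow> real"
  assumes "finite X" "finite Y" "\<And>x. x \<in> X \<Longrightarrow> \<phi> x \<in> Y"
  shows "(\<Sum>x\<in>X. F (\<phi> x)) = (\<Sum>y\<in>Y. real (card {x\<in>X. \<phi> x = y}) * F y)"
proof -
  have "(\<Sum>x\<in>X. F (\<phi> x)) = (\<Sum>y\<in>Y. \<Sum>x\<in>{x\<in>X. \<phi> x = y}. F (\<phi> x))"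
    using assms by (subst sum.group) auto
  also have "\<dots> = (\<Sum>y\<in>Y. real (card {x\<in>X. \<phi> x = y}) * F y)"
    by (intro sum.cong refl) simp
  finally show ?thesis .
qed

text \<open>The \<open>t\<close> fibres partition \<open>X\<close> and have equal size. For the
  periods of one subject this is used with 1 in place of \<open>g\<close>, for the subjects of one
  period with \<open>g\<close> itself.\<close>

lemma card_fibre_equal:
  assumes "finite X" "\<And>x. x \<in> X \<Longrightarrow> \<phi> x < t" "card X = g * t"
    and eq: "\<And>a b. a < t \<Longrightarrow> b < t \<Longrightarrow> card {x\<in>X. \<phi> x = a} = card {x\<in>X. \<phi> x = b}"
    and "a < t"
  shows "card {x\<in>X. \<phi> x = a} = g"
proof -
  have "real (card X) = (\<Sum>b<t. real (card {x\<in>X. \<phi> x = b}) * 1)"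
    using sum_comp_card[OF assms(1), of "{..<t}" \<phi> "\<lambda>_. 1"] assms(2) by simp
  also have "\<dots> = (\<Sum>b<t. real (card {x\<in>X. \<phi> x = a}))"
    unfolding mult_1_right by (intro sum.cong refl arg_cong[where f = real] eq \<open>a < t\<close>) simp
  finally have "real g * real t = real t * real (card {x\<in>X. \<phi> x = a})"
    using assms(3) by simp
  then show ?thesis using \<open>a < t\<close> by simp
qed

context
  fixes g t :: nat and d :: design
  assumes d: "ubrmd g t d"
begin

lemma ubrmd_less: "k \<in> {1..t} \<Longrightarrow> i \<in> {1..g * t} \<Longrightarrow> d k i < t"
  using d unfolding ubrmd_def crossover_design_def by blast

lemma period_fibre_eq:
  "i \<in> {1..g * t} \<Longrightarrow> a < t \<Longrightarrow> b < t \<Longrightarrow>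
    card {k\<in>{1..t}. d k i = a} = card {k\<in>{1..t}. d k i = b}"
  using d unfolding ubrmd_def uniform_design_def by blast

lemma subject_fibre_eq:
  "k \<in> {1..t} \<Longrightarrow> a < t \<Longrightarrow> b < t \<Longrightarrow>
    card {i\<in>{1..g * t}. d k i = a} = card {i\<in>{1..g * t}. d k i = b}"
  using d unfolding ubrmd_def uniform_design_def by blast

lemma sum_periods:
  fixes f :: "nat \<Rightarrow> real"
  assumes i: "i \<in> {1..g * t}"
  shows "(\<Sum>k=1..t. f (d k i)) = (\<Sum>a<t. f a)"
proof -
  have "(\<Sum>k=1..t. f (d k i)) = (\<Sum>a<t. real (card {k\<in>{1..t}. d k i = a}) * f a)"
    by (rule sum_comp_card) (use ubrmd_less i in auto)
  also have "\<dots> = (\<Sum>a<t. f a)"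
  proof (intro sum.cong refl)
    fix a assume "a \<in> {..<t}"
    then have "card {k\<in>{1..t}. d k i = a} = 1"
      using ubrmd_less i by (intro card_fibre_equal[OF _ _ _ period_fibre_eq[OF i]]) auto
    then show "real (card {k\<in>{1..t}. d k i = a}) * f a = f a" by simp
  qed
  finally show ?thesis .
qed

lemma sum_subjects:
  fixes f :: "nat \<Rightarrow> real"
  assumes k: "k \<in> {1..t}"
  shows "(\<Sum>i=1..g*t. f (d k i)) = real g * (\<Sum>a<t. f a)"
proof -
  have "(\<Sum>i=1..g*t. f (d k i)) = (\<Sum>a<t. real (card {i\<in>{1..g*t}. d k i = a}) * f a)"
    by (rule sum_comp_card) (use ubrmd_less k in auto)
  also have "\<dots> = (\<Sum>a<t. real g * f a)"
  proof (intro sum.cong refl)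
    fix a assume "a \<in> {..<t}"
    then have "card {i\<in>{1..g*t}. d k i = a} = g"
      using ubrmd_less k by (intro card_fibre_equal[OF _ _ _ subject_fibre_eq[OF k]]) auto
    then show "real (card {i\<in>{1..g*t}. d k i = a}) * f a = real g * f a" by simp
  qed
  finally show ?thesis by (simp add: sum_distrib_left)
qed

text \<open>Balance gives every ordered pair of distinct treatments the same number \<open>l\<close>
  of transitions and the diagonal none, so the sum is \<open>l\<close> times the full product minus
  its diagonal. It remains to identify \<open>l\<close> with \<open>g\<close>.\<close>

lemma sum_transitions:
  fixes f h :: "nat \<Rightarrow> real"
  assumes "2 \<le> t"
  shows "(\<Sum>k=2..t. \<Sum>i=1..g*t. f (d k i) * h (d (k-1) i)) =
     real g * ((\<Sum>a<t. f a) * (\<Sum>a<t. h a) - (\<Sum>a<t. f a * h a))"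
proof -
  obtain l where l: "\<forall>a<t. \<forall>b<t. a \<noteq> b \<longrightarrow> preceded_count t (g * t) d a b = l"
    and l0: "\<forall>a<t. preceded_count t (g * t) d a a = 0"
    using d unfolding ubrmd_def balanced_design_def by blast
  have gen: "(\<Sum>k=2..t. \<Sum>i=1..g*t. f (d k i) * h (d (k-1) i)) =
     real l * ((\<Sum>a<t. f a) * (\<Sum>a<t. h a) - (\<Sum>a<t. f a * h a))" for f h :: "nat \<Rightarrow> real"
  proof -
    have "(\<Sum>k=2..t. \<Sum>i=1..g*t. f (d k i) * h (d (k-1) i)) =
       (\<Sum>x\<in>{2..t}\<times>{1..g*t}. (\<lambda>(a,b). f a * h b) ((\<lambda>(k,i). (d k i, d (k-1) i)) x))"
      by (simp add: sum.cartesian_product case_prod_unfold)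
    also have "\<dots> = (\<Sum>y\<in>{..<t}\<times>{..<t}.
        real (card {x\<in>{2..t}\<times>{1..g*t}. (\<lambda>(k,i). (d k i, d (k-1) i)) x = y}) *
          (case y of (a,b) \<Rightarrow> f a * h b))"
      by (rule sum_comp_card) (auto intro!: ubrmd_less)
    also have "\<dots> = (\<Sum>y\<in>{..<t}\<times>{..<t}. case y of (a,b) \<Rightarrow>
        real l * (f a * h b) - (if a = b then real l * (f a * h b) else 0))"
    proof (intro sum.cong refl)
      fix y assume "y \<in> {..<t}\<times>{..<t}"
      then obtain a b where y: "y = (a,b)" and ab: "a < t" "b < t" by auto
      have "card {x\<in>{2..t}\<times>{1..g*t}. (\<lambda>(k,i). (d k i, d (k-1) i)) x = y} =
         preceded_count t (g * t) d a b"
        unfolding preceded_count_def y by (rule arg_cong[where f = card]) auto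
      also have "\<dots> = (if a = b then 0 else l)" using l l0 ab by simp
      finally have "card {x\<in>{2..t}\<times>{1..g*t}. (\<lambda>(k,i). (d k i, d (k-1) i)) x = y} =
        (if a = b then 0 else l)" .
      then show "real (card {x\<in>{2..t}\<times>{1..g*t}. (\<lambda>(k,i). (d k i, d (k-1) i)) x = y}) *
          (case y of (a,b) \<Rightarrow> f a * h b) = (case y of (a,b) \<Rightarrow>
          real l * (f a * h b) - (if a = b then real l * (f a * h b) else 0))"
        unfolding y by simp
    qed
    also have "\<dots> = real l * ((\<Sum>a<t. f a) * (\<Sum>a<t. h a) - (\<Sum>a<t. f a * h a))"
      by (simp flip: sum.cartesian_product sum_distrib_left
          add: sum_subtractf sum_product right_diff_distrib)
    finally show ?thesis .
  qed
  \<comment> \<open>Constant functions count all transitions: \<open>g * t\<close> subjects with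
    \<open>t - 1\<close> transitions each, against \<open>l\<close> for each of the
    \<open>t * t - t\<close> ordered pairs.\<close>
  have "(real t - 1) * (real g * real t) = real l * (real t * real t - real t)"
    using gen[of "\<lambda>_. 1" "\<lambda>_. 1"] assms by (simp add: of_nat_diff)
  then have "(real l - real g) * (real t * (real t - 1)) = 0" by (simp add: algebra_simps)
  then have "real l = real g" using assms by simp
  then show ?thesis using gen by simp
qed

end

section \<open>Minkowski and Cauchy-Schwarz for \<open>L2_set\<close>\<close>

text \<open>Iterated triangle inequality; for infinite \<open>K\<close> both sides are 0.\<close>

lemma L2_set_sum_le: "L2_set (\<lambda>i. \<Sum>k\<in>K. f k i) A \<le> (\<Sum>k\<in>K. L2_set (f k) A)"
proof (induction K rule: infinite_finite_induct)
  case (insert k K)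
  then show ?case
    using L2_set_triangle_ineq[of "f k" "\<lambda>i. \<Sum>k\<in>K. f k i" A] by simp
qed (auto simp: L2_set_def)

lemma sum_mult_le_L2_set:
  "\<bar>\<Sum>i\<in>A. f i * h i\<bar> \<le> L2_set f A * L2_set h A"
proof -
  have "\<bar>\<Sum>i\<in>A. f i * h i\<bar> \<le> (\<Sum>i\<in>A. \<bar>f i\<bar> * \<bar>h i\<bar>)"
    by (rule order.trans[OF sum_abs]) (simp add: abs_mult)
  then show ?thesis using L2_set_mult_ineq[of f h A] by linarith
qed

section \<open>The kernel of the truncated model\<close>

lemma L2_set_power2: "(L2_set f A)\<^sup>2 = (\<Sum>i\<in>A. (f i)\<^sup>2)"
  unfolding L2_set_def by (simp add: sum_nonneg)

lemma sum_shifted: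
  fixes f :: "nat \<Rightarrow> real"
  shows "(\<Sum>k=1..p. if k = 1 then 0 else f (k - 1)) = (\<Sum>k=1..<p. f k)"
proof (induction p)
  case (Suc p)
  then show ?case by (cases "p = 0") auto
qed simp

text \<open>Each treatment occurs \<open>g\<close> times in a period, so passing from treatments to
  the subjects of one period multiplies the squared norm by \<open>g\<close>.\<close>

lemma L2_set_subjects:
  assumes "ubrmd g t d" "k \<in> {1..t}"
  shows "L2_set (\<lambda>i. f (d k i)) {1..g*t} = sqrt (real g) * L2_set f {..<t}"
  unfolding L2_set_def using sum_subjects[OF assms, of "\<lambda>a. (f a)\<^sup>2"] by (simp add: real_sqrt_mult)

text \<open>The quantity \<open>p\<close> times the sum of the squares of \<open>u\<close> is
  estimated twice: from below by expanding the squares period by period (\<open>lower\<close>), from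
  above by writing \<open>p * u i\<close> through the omitted periods (\<open>upper\<close>). The
  factor \<open>g\<close> cancels at the end.\<close>

lemma centered_kernel_bound:
  fixes \<alpha> \<beta> \<tau> \<rho> :: "nat \<Rightarrow> real"
  assumes d: "ubrmd g t d" and g: "1 \<le> g" and t: "t = p + m" "2 \<le> t" and p: "1 \<le> p"
    and s\<tau>: "(\<Sum>a<t. \<tau> a) = 0" and s\<rho>: "(\<Sum>a<t. \<rho> a) = 0"
    and ker: "\<And>k i. k \<in> {1..p} \<Longrightarrow> i \<in> {1..g*t} \<Longrightarrow>
      \<beta> i + \<alpha> k + \<tau> (d k i) + (if k = 1 then 0 else \<rho> (d (k-1) i)) = 0"
  defines "x \<equiv> L2_set \<tau> {..<t}" and "y \<equiv> L2_set \<rho> {..<t}"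
  shows "real p * x\<^sup>2 + (real p - 1) * y\<^sup>2 - 2 * (real m + 1) * x * y
    \<le> (real m * x + (real m + 1) * y)\<^sup>2 / real p"
proof -
  define I where "I = {1..g*t}"
  define z where "z k i = \<tau> (d k i) + (if k = 1 then 0 else \<rho> (d (k-1) i))" for k i
  \<comment> \<open>This will be the value of \<open>z k i\<close> common to all retained periods:
    the period effects turn out to be minus the mean of \<open>\<beta>\<close>.\<close>
  define u where "u i = (\<Sum>i\<in>I. \<beta> i) / real (g*t) - \<beta> i" for i
  define c where "c k = (\<Sum>i\<in>I. \<tau> (d k i) * \<rho> (d (k-1) i))" for k
  have gt: "real (g*t) > 0" using g t by simp
  have xy: "0 \<le> x" "0 \<le> y" unfolding x_def y_def by simp_all
  have zu: "z k i = u i" if k: "k \<in> {1..p}" and i: "i \<in> I" for k i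
  proof -
    \<comment> \<open>Centred effects cancel over the subjects of a period, so summing the kernel
      equation over the subjects determines \<open>\<alpha> k\<close>.\<close>
    have "(\<Sum>i\<in>I. \<tau> (d k i)) = 0"
      unfolding I_def using sum_subjects[OF d, of k \<tau>] k t s\<tau> by simp
    moreover have "(\<Sum>i\<in>I. if k = 1 then 0 else \<rho> (d (k-1) i)) = 0"
      unfolding I_def using sum_subjects[OF d, of "k-1" \<rho>] k t s\<rho> by (cases "k = 1") (simp_all, linarith)
    ultimately have "(\<Sum>i\<in>I. z k i) = 0" unfolding z_def by (simp only: sum.distrib)
    moreover have "(\<Sum>i\<in>I. \<beta> i + \<alpha> k + z k i) = 0"
      using ker[OF k] unfolding z_def I_def by (intro sum.neutral) (simp add: add.assoc)
    ultimately have "(\<Sum>i\<in>I. \<beta> i) + real (g*t) * \<alpha> k = 0"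
      unfolding I_def by (simp add: sum.distrib)
    then have "\<alpha> k = - (\<Sum>i\<in>I. \<beta> i) / real (g*t)"
      using gt by (simp add: field_simps del: of_nat_mult)
    then show ?thesis using ker[OF k, of i] i unfolding z_def u_def I_def by simp
  qed
  \<comment> \<open>Centred effects also cancel over all \<open>t\<close> periods of a subject, so
    the retained sum is minus the omitted one. Carry-over within the retained periods comes only
    from periods \<open>1\<close> to \<open>p - 1\<close>; hence \<open>m\<close> direct but
    \<open>m + 1\<close> carry-over terms are omitted.\<close>
  have pu: "real p * u i = - ((\<Sum>k=p+1..t. \<tau> (d k i)) + (\<Sum>k=p..t. \<rho> (d k i)))"
    if i: "i \<in> I" for i
  proof -
    have "real p * u i = (\<Sum>k=1..p. z k i)" using zu[OF _ i] by simp
    also have "\<dots> = (\<Sum>k=1..p. \<tau> (d k i)) + (\<Sum>k=1..<p. \<rho> (d k i))"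
      unfolding z_def sum.distrib using sum_shifted[of "\<lambda>k. \<rho> (d k i)" p] by simp
    also have "(\<Sum>k=1..p. \<tau> (d k i)) = - (\<Sum>k=p+1..t. \<tau> (d k i))"
      using sum.ub_add_nat[of 1 p "\<lambda>k. \<tau> (d k i)" m] sum_periods[OF d, of i \<tau>] i s\<tau> t
      unfolding I_def by simp
    also have "(\<Sum>k=1..<p. \<rho> (d k i)) = - (\<Sum>k=p..t. \<rho> (d k i))"
      using sum.atLeastLessThan_concat[of 1 p "Suc t" "\<lambda>k. \<rho> (d k i)"] p
        sum_periods[OF d, of i \<rho>] i s\<rho> t
      unfolding I_def by (simp flip: atLeastLessThanSuc_atLeastAtMost)
    finally show ?thesis by simp
  qed
  have upper: "(real p)\<^sup>2 * (\<Sum>i\<in>I. (u i)\<^sup>2) \<le> real g * (real m * x + (real m + 1) * y)\<^sup>2"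
  proof -
    have "real p * L2_set u I = L2_set (\<lambda>i. (\<Sum>k=p+1..t. \<tau> (d k i)) + (\<Sum>k=p..t. \<rho> (d k i))) I"
      unfolding L2_set_right_distrib[OF of_nat_0_le_iff] unfolding L2_set_def
      by (intro arg_cong[where f = sqrt] sum.cong refl) (simp only: pu power2_minus)
    also have "\<dots> \<le> L2_set (\<lambda>i. \<Sum>k=p+1..t. \<tau> (d k i)) I + L2_set (\<lambda>i. \<Sum>k=p..t. \<rho> (d k i)) I"
      by (rule L2_set_triangle_ineq)
    also have "\<dots> \<le> (\<Sum>k=p+1..t. L2_set (\<lambda>i. \<tau> (d k i)) I) + (\<Sum>k=p..t. L2_set (\<lambda>i. \<rho> (d k i)) I)"
      by (intro add_mono L2_set_sum_le)
    also have "\<dots> = (\<Sum>k=p+1..t. sqrt g * x) + (\<Sum>k=p..t. sqrt g * y)"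
      unfolding I_def x_def y_def using p
      by (intro arg_cong2[where f = "(+)"] sum.cong refl L2_set_subjects[OF d]) auto
    also have "\<dots> = sqrt g * (real m * x + (real m + 1) * y)"
      using t by (simp add: algebra_simps)
    finally have "(real p * L2_set u I)\<^sup>2 \<le> (sqrt g * (real m * x + (real m + 1) * y))\<^sup>2"
      by (rule power_mono) simp
    then show ?thesis by (simp add: power_mult_distrib L2_set_power2)
  qed
  have cb: "\<bar>c k\<bar> \<le> real g * x * y" if "k \<in> {2..t}" for k
  proof -
    have k: "k \<in> {1..t}" "k - 1 \<in> {1..t}" using that by auto
    have "\<bar>c k\<bar> \<le> sqrt g * x * (sqrt g * y)"
      using sum_mult_le_L2_set[of "\<lambda>i. \<tau> (d k i)" "\<lambda>i. \<rho> (d (k-1) i)" I]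
      unfolding c_def I_def x_def y_def L2_set_subjects[OF d k(1)] L2_set_subjects[OF d k(2)] .
    also have "\<dots> = (sqrt g * sqrt g) * x * y" by (simp only: mult_ac)
    finally show ?thesis by simp
  qed
  \<comment> \<open>Over the full design the cross terms add up to at least
    \<open>- g * x * y\<close>, and each of the \<open>m\<close> deleted transitions accounts for at
    most \<open>g * x * y\<close> by \<open>cb\<close>. This is the origin of the factor
    \<open>m + 1\<close> in \<open>cross\<close>.\<close>
  have "(\<Sum>k=2..t. c k) = - real g * (\<Sum>a<t. \<tau> a * \<rho> a)"
    unfolding c_def I_def using sum_transitions[OF d t(2), of \<tau> \<rho>] s\<tau> by simp
  moreover have "\<bar>\<Sum>a<t. \<tau> a * \<rho> a\<bar> \<le> x * y"
    unfolding x_def y_def by (rule sum_mult_le_L2_set)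
  then have "real g * (\<Sum>a<t. \<tau> a * \<rho> a) \<le> real g * (x * y)"
    by (intro mult_left_mono) auto
  moreover have "(\<Sum>k=2..t. c k) = (\<Sum>k=2..p. c k) + (\<Sum>k=p+1..t. c k)"
    using sum.ub_add_nat[of 2 p c m] p t by simp
  moreover have "(\<Sum>k=p+1..t. c k) \<le> (\<Sum>k=p+1..t. real g * x * y)"
    using p by (intro sum_mono abs_le_D1[OF cb]) auto
  then have "(\<Sum>k=p+1..t. c k) \<le> real m * (real g * x * y)"
    using t by simp
  ultimately have cross: "(\<Sum>k=2..p. c k) \<ge> - real g * (real m + 1) * x * y"
    by (simp add: algebra_simps)
  have zsq: "(\<Sum>i\<in>I. (z k i)\<^sup>2) = real g * x\<^sup>2 + (if k = 1 then 0 else real g * y\<^sup>2 + 2 * c k)"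
    if k: "k \<in> {1..p}" for k
  proof -
    have "(\<Sum>i\<in>I. (\<tau> (d k i))\<^sup>2) = real g * x\<^sup>2"
      unfolding I_def x_def L2_set_power2 using sum_subjects[OF d, of k "\<lambda>a. (\<tau> a)\<^sup>2"] k t by simp
    moreover have "(\<Sum>i\<in>I. (\<rho> (d (k-1) i))\<^sup>2) = real g * y\<^sup>2" if "k \<noteq> 1"
      unfolding I_def y_def L2_set_power2
      using sum_subjects[OF d, of "k-1" "\<lambda>a. (\<rho> a)\<^sup>2"] k t that by (simp, linarith)
    ultimately show ?thesis
      unfolding z_def c_def by (simp add: power2_sum sum.distrib sum_distrib_left mult.assoc)
  qed
  \<comment> \<open>Period 1 has no carry-over, which leaves \<open>p\<close> copies of
    \<open>x\<close> squared but only \<open>p - 1\<close> of \<open>y\<close> squared.\<close>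
  have "real p * (\<Sum>i\<in>I. (u i)\<^sup>2) = (\<Sum>k=1..p. \<Sum>i\<in>I. (z k i)\<^sup>2)"
    using zu by simp
  also have "\<dots> = (\<Sum>k=1..p. real g * x\<^sup>2 + (if k = 1 then 0 else real g * y\<^sup>2 + 2 * c k))"
    using zsq by (intro sum.cong) auto
  also have "\<dots> = real p * (real g * x\<^sup>2) + (\<Sum>k=2..p. real g * y\<^sup>2 + 2 * c k)"
    using p by (simp add: sum.distrib sum.atLeast_Suc_atMost numeral_2_eq_2)
  also have "\<dots> = real g * (real p * x\<^sup>2 + (real p - 1) * y\<^sup>2) + 2 * (\<Sum>k=2..p. c k)"
    using p by (simp add: sum.distrib sum_distrib_left of_nat_diff algebra_simps)
  finally have lower: "real g * (real p * x\<^sup>2 + (real p - 1) * y\<^sup>2 - 2 * (real m + 1) * x * y)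
      \<le> real p * (\<Sum>i\<in>I. (u i)\<^sup>2)"
    using cross by (simp add: algebra_simps)
  have "real p * (\<Sum>i\<in>I. (u i)\<^sup>2) \<le> real g * ((real m * x + (real m + 1) * y)\<^sup>2 / real p)"
    using upper p by (simp add: field_simps power2_eq_square)
  with lower have "real g * (real p * x\<^sup>2 + (real p - 1) * y\<^sup>2 - 2 * (real m + 1) * x * y)
      \<le> real g * ((real m * x + (real m + 1) * y)\<^sup>2 / real p)" by linarith
  then show ?thesis by (rule mult_left_le_imp_le) (use g in simp)
qed


text \<open>The bound is applied to the deviations of \<open>\<tau>\<close> and
  \<open>\<rho>\<close> from their means. The arithmetic of \<open>p\<close> and \<open>m\<close> is
  isolated in the hypothesis \<open>definite\<close>, so that one argument serves all ranges of
  \<open>m\<close> and \<open>t\<close>.\<close>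

lemma kernel_direct_effects_constant:
  fixes \<alpha> \<beta> \<tau> \<rho> :: "nat \<Rightarrow> real"
  assumes d: "ubrmd g t d" and g: "1 \<le> g" and t: "t = p + m" "2 \<le> t" and p: "1 \<le> p"
    and definite: "\<And>x y. 0 \<le> x \<Longrightarrow> 0 \<le> y \<Longrightarrow>
      real p * x\<^sup>2 + (real p - 1) * y\<^sup>2 - 2 * (real m + 1) * x * y
        \<le> (real m * x + (real m + 1) * y)\<^sup>2 / real p \<Longrightarrow> x = 0"
    and ker: "\<And>k i. k \<in> {1..p} \<Longrightarrow> i \<in> {1..g*t} \<Longrightarrow>
      \<beta> i + \<alpha> k + \<tau> (d k i) + (if k = 1 then 0 else \<rho> (d (k-1) i)) = 0"
  shows "\<exists>c. \<forall>a<t. \<tau> a = c"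
proof -
  define \<tau>m where "\<tau>m = (\<Sum>a<t. \<tau> a) / real t"
  define \<rho>m where "\<rho>m = (\<Sum>a<t. \<rho> a) / real t"
  have "L2_set (\<lambda>a. \<tau> a - \<tau>m) {..<t} = 0"
  proof (rule definite)
    show "real p * (L2_set (\<lambda>a. \<tau> a - \<tau>m) {..<t})\<^sup>2 + (real p - 1) * (L2_set (\<lambda>a. \<rho> a - \<rho>m) {..<t})\<^sup>2
      - 2 * (real m + 1) * L2_set (\<lambda>a. \<tau> a - \<tau>m) {..<t} * L2_set (\<lambda>a. \<rho> a - \<rho>m) {..<t}
      \<le> (real m * L2_set (\<lambda>a. \<tau> a - \<tau>m) {..<t}
        + (real m + 1) * L2_set (\<lambda>a. \<rho> a - \<rho>m) {..<t})\<^sup>2 / real p"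
    proof (rule centered_kernel_bound[OF d g t p])
      \<comment> \<open>Period effects absorb both means; that of \<open>\<rho>\<close> enters only
        from period 2 on.\<close>
      show "\<beta> i + (\<alpha> k + \<tau>m + (if k = 1 then 0 else \<rho>m)) + (\<tau> (d k i) - \<tau>m)
          + (if k = 1 then 0 else \<rho> (d (k-1) i) - \<rho>m) = 0"
        if "k \<in> {1..p}" "i \<in> {1..g*t}" for k i
        using ker[OF that] by (simp split: if_splits)
    qed (use t in \<open>simp_all add: \<tau>m_def \<rho>m_def sum_subtractf\<close>)
  qed simp_all
  then show ?thesis by (auto simp: L2_set_eq_0_iff)
qed

section \<open>Definiteness of the quadratic form\<close>

text \<open>Replacing \<open>p\<close> by a smaller positive \<open>q\<close> lowers the left side
  and raises the right side, so each range of \<open>p\<close> needs checking only at its least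
  value.\<close>

lemma definite_mono:
  fixes p q m x y :: real
  assumes "0 < q" "q \<le> p"
    and "p * x\<^sup>2 + (p - 1) * y\<^sup>2 - 2 * (m + 1) * x * y \<le> (m * x + (m + 1) * y)\<^sup>2 / p"
  shows "q * x\<^sup>2 + (q - 1) * y\<^sup>2 - 2 * (m + 1) * x * y \<le> (m * x + (m + 1) * y)\<^sup>2 / q"
proof -
  have "q * x\<^sup>2 \<le> p * x\<^sup>2" "(q - 1) * y\<^sup>2 \<le> (p - 1) * y\<^sup>2"
    using assms by (simp_all add: mult_right_mono)
  moreover have "(m * x + (m + 1) * y)\<^sup>2 / p \<le> (m * x + (m + 1) * y)\<^sup>2 / q"
    using assms by (intro divide_left_mono) auto
  ultimately show ?thesis using assms(3) by linarith
qed

lemma definite_1: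
  fixes x y :: real
  assumes "4 * x\<^sup>2 + (4 - 1) * y\<^sup>2 - 2 * (1 + 1) * x * y \<le> (1 * x + (1 + 1) * y)\<^sup>2 / 4"
  shows "x = 0"
proof -
  \<comment> \<open>Clearing the denominator leaves 15 x^2 - 20 x y + 8 y^2; completing the square
    in twice this form gives the left side.\<close>
  have "(5 * x - 4 * y)\<^sup>2 + 5 * x\<^sup>2 \<le> 0"
    using assms by (simp add: power2_eq_square algebra_simps)
  then show ?thesis by (smt (verit) zero_le_power2 zero_eq_power2)
qed

lemma definite_2:
  fixes x y :: real
  assumes "6 * x\<^sup>2 + (6 - 1) * y\<^sup>2 - 2 * (2 + 1) * x * y \<le> (2 * x + (2 + 1) * y)\<^sup>2 / 6"
  shows "x = 0"
proof -
  \<comment> \<open>Here the cleared form is 32 x^2 - 48 x y + 21 y^2, and the left side is seven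
    times it.\<close>
  have "3 * (8 * x - 7 * y)\<^sup>2 + 32 * x\<^sup>2 \<le> 0"
    using assms by (simp add: power2_eq_square algebra_simps)
  then show ?thesis by (smt (verit) zero_le_power2 zero_eq_power2)
qed

text \<open>For nonnegative \<open>x\<close> and \<open>y\<close>, enlarging \<open>m * x\<close> to
  \<open>(m + 1) * x\<close> makes the right side a multiple of (x + y)^2. After multiplication by 3
  the difference of the two sides becomes a sum of squares with nonnegative coefficients.\<close>

lemma definite_general:
  fixes m x y :: real
  assumes "0 \<le> m" "0 \<le> x" "0 \<le> y"
    and "3 * (m + 1) * x\<^sup>2 + (3 * (m + 1) - 1) * y\<^sup>2 - 2 * (m + 1) * x * y
      \<le> (m * x + (m + 1) * y)\<^sup>2 / (3 * (m + 1))"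
  shows "x = 0"
proof -
  have "(m * x + (m + 1) * y)\<^sup>2 \<le> ((m + 1) * (x + y))\<^sup>2"
    using assms by (intro power_mono) (auto simp: algebra_simps)
  then have "(m * x + (m + 1) * y)\<^sup>2 / (3 * (m + 1)) \<le> ((m + 1) * (x + y))\<^sup>2 / (3 * (m + 1))"
    using assms by (intro divide_right_mono) auto
  also have "\<dots> = (m + 1) * (x + y)\<^sup>2 / 3"
    using assms by (simp add: field_simps power2_eq_square)
  finally have "3 * (m + 1) * x\<^sup>2 + (3 * (m + 1) - 1) * y\<^sup>2 - 2 * (m + 1) * x * y
      \<le> (m + 1) * (x + y)\<^sup>2 / 3" using assms(4) by linarith
  then have "(m + 1) * (4 * (x - y)\<^sup>2 + 4 * x\<^sup>2) + (4 * m + 1) * y\<^sup>2 \<le> 0"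
    by (simp add: power2_eq_square algebra_simps)
  moreover have "0 \<le> (4 * m + 1) * y\<^sup>2" using assms by simp
  ultimately have "(m + 1) * (4 * (x - y)\<^sup>2 + 4 * x\<^sup>2) \<le> 0" by linarith
  then have "4 * (x - y)\<^sup>2 + 4 * x\<^sup>2 \<le> 0"
    using assms by (simp add: mult_le_0_iff)
  then show ?thesis by (smt (verit) zero_le_power2 zero_eq_power2)
qed

section \<open>Schur complements of Gram matrices\<close>

lemma scalar_prod_self_eq_0:
  fixes v :: "real vec"
  assumes "v \<in> carrier_vec n" "v \<bullet> v = 0"
  shows "v = 0\<^sub>v n"
proof (rule eq_vecI)
  fix i assume i: "i < dim_vec (0\<^sub>v n :: real vec)"
  have "(\<Sum>i\<in>{0..<n}. v $ i * v $ i) = 0" using assms by (simp add: scalar_prod_def)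
  then have "\<forall>i\<in>{0..<n}. v $ i * v $ i = 0" by (subst (asm) sum_nonneg_eq_0_iff) auto
  then show "v $ i = 0\<^sub>v n $ i" using i by simp
qed (use assms in simp)

lemma mult_transpose_eq_0:
  fixes A :: "real mat"
  assumes A: "A \<in> carrier_mat m n" and "A * A\<^sup>T = 0\<^sub>m m m"
  shows "A = 0\<^sub>m m n"
proof (rule eq_matI)
  fix i j assume i: "i < dim_row (0\<^sub>m m n :: real mat)" and j: "j < dim_col (0\<^sub>m m n :: real mat)"
  have "row A i \<bullet> row A i = (A * A\<^sup>T) $$ (i, i)" using A i by simp
  also have "\<dots> = 0" using assms i by simp
  finally have "row A i = 0\<^sub>v n" using A by (intro scalar_prod_self_eq_0) auto
  then have "row A i $ j = 0" using j by simp
  then show "A $$ (i, j) = 0\<^sub>m m n $$ (i, j)" using A i j by simp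
qed (use A in auto)

lemma gram_ginverse_absorb:
  fixes E G :: "real mat"
  assumes E: "E \<in> carrier_mat n u" and G: "G \<in> carrier_mat u u"
    and gi: "(E\<^sup>T * E) * G * (E\<^sup>T * E) = E\<^sup>T * E"
  shows "(E\<^sup>T * E) * G * E\<^sup>T = E\<^sup>T"
proof -
  \<comment> \<open>\<open>M * E = 0\<close> and \<open>M\<^sup>T = E * (H\<^sup>T - 1)\<close>, so \<open>M * M\<^sup>T = 0\<close>.\<close>
  define H where "H = (E\<^sup>T * E) * G"
  define M where "M = H * E\<^sup>T - E\<^sup>T"
  have H: "H \<in> carrier_mat u u" and M: "M \<in> carrier_mat u n"
    unfolding H_def M_def using E G by auto
  have ME: "M * E = 0\<^sub>m u u"
  proof -
    have "M * E = H * E\<^sup>T * E - E\<^sup>T * E"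
      unfolding M_def using E H by (intro minus_mult_distrib_mat[of _ u n]) auto
    also have "H * E\<^sup>T * E = E\<^sup>T * E"
      using gi E H unfolding H_def[symmetric] by (subst assoc_mult_mat[of _ u u _ n _ u]) auto
    finally show ?thesis using E by auto
  qed
  have "M\<^sup>T = E * H\<^sup>T - E"
    unfolding M_def using E H by (subst transpose_minus[of _ u n]) (auto simp: transpose_mult)
  then have "M * M\<^sup>T = M * (E * H\<^sup>T) - M * E"
    using E H M by (simp add: mult_minus_distrib_mat[of M u n _ u])
  also have "M * (E * H\<^sup>T) = M * E * H\<^sup>T"
    using E H M by (intro assoc_mult_mat[symmetric]) auto
  finally have "M * M\<^sup>T = 0\<^sub>m u u" unfolding ME using H by auto
  then have "M = 0\<^sub>m u n" by (rule mult_transpose_eq_0[OF M])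
  then show ?thesis
    unfolding H_def[symmetric] M_def using E H
    by (intro eq_matI) (auto dest: arg_cong[where f = "\<lambda>A. A $$ _"] simp: mat_eq_iff)
qed

text \<open>By \<open>gram_ginverse_absorb\<close>, \<open>K\<close> solves the normal equations for
  regressing the columns of \<open>D\<close> on those of \<open>E\<close>, so \<open>N\<close> holds
  residuals orthogonal to \<open>E\<close>. Since \<open>D\<^sup>T * N\<close> is the Schur
  complement, \<open>y = N *\<^sub>v x\<close> is orthogonal to the columns of both \<open>D\<close>
  and \<open>E\<close>. It is also a combination of them, hence zero, and \<open>z\<close> is minus
  \<open>K *\<^sub>v x\<close>.\<close>

lemma schur_complement_kernel:
  fixes D E G :: "real mat"
  assumes D: "D \<in> carrier_mat n t" and E: "E \<in> carrier_mat n u" and G: "G \<in> carrier_mat u u"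
    and gi: "(E\<^sup>T * E) * G * (E\<^sup>T * E) = E\<^sup>T * E"
    and x: "x \<in> carrier_vec t"
    and ker: "(D\<^sup>T * D - D\<^sup>T * E * G * (E\<^sup>T * D)) *\<^sub>v x = 0\<^sub>v t"
  shows "\<exists>z\<in>carrier_vec u. D *\<^sub>v x + E *\<^sub>v z = 0\<^sub>v n"
proof -
  define K where "K = G * (E\<^sup>T * D)"
  define N where "N = D - E * K"
  define y where "y = N *\<^sub>v x"
  have K: "K \<in> carrier_mat u t" unfolding K_def using D E G by auto
  have N: "N \<in> carrier_mat n t" unfolding N_def using D E K by auto
  have y: "y \<in> carrier_vec n" unfolding y_def using N x by auto
  have "E\<^sup>T * N = E\<^sup>T * D - E\<^sup>T * (E * K)"
    unfolding N_def using D E K by (intro mult_minus_distrib_mat[of _ u n]) auto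
  also have "E\<^sup>T * (E * K) = (E\<^sup>T * E) * K"
    using E K by (intro assoc_mult_mat[symmetric, of _ u n _ u _ t]) auto
  also have "\<dots> = (E\<^sup>T * E) * G * (E\<^sup>T * D)"
    unfolding K_def using D E G by (intro assoc_mult_mat[symmetric, of _ u u _ u _ t]) auto
  also have "\<dots> = (E\<^sup>T * E) * G * E\<^sup>T * D"
    using D E G by (intro assoc_mult_mat[symmetric, of _ u u _ n _ t]) auto
  also have "\<dots> = E\<^sup>T * D" unfolding gram_ginverse_absorb[OF E G gi] ..
  finally have "E\<^sup>T * N = 0\<^sub>m u t" using D E by auto
  then have Ey: "E\<^sup>T *\<^sub>v y = 0\<^sub>v u"
    unfolding y_def using E N x by (subst assoc_mult_mat_vec[symmetric, of _ u n _ t]) auto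
  have "D\<^sup>T * N = D\<^sup>T * D - D\<^sup>T * (E * K)"
    unfolding N_def using D E K by (intro mult_minus_distrib_mat[of _ t n]) auto
  also have "D\<^sup>T * (E * K) = (D\<^sup>T * E) * K"
    using D E K by (intro assoc_mult_mat[symmetric, of _ t n _ u _ t]) auto
  also have "\<dots> = D\<^sup>T * E * G * (E\<^sup>T * D)"
    unfolding K_def using D E G by (intro assoc_mult_mat[symmetric, of _ t u _ u _ t]) auto
  finally have Dy: "D\<^sup>T *\<^sub>v y = 0\<^sub>v t"
    unfolding y_def using D N x ker by (subst assoc_mult_mat_vec[symmetric, of _ t n _ t]) auto
  have "N\<^sup>T = D\<^sup>T - K\<^sup>T * E\<^sup>T"
    unfolding N_def using D E K by (subst transpose_minus[of _ n t]) (auto simp: transpose_mult)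
  then have "N\<^sup>T *\<^sub>v y = D\<^sup>T *\<^sub>v y - K\<^sup>T * E\<^sup>T *\<^sub>v y"
    using D E K y by (simp add: minus_mult_distrib_mat_vec[of _ t n])
  also have "K\<^sup>T * E\<^sup>T *\<^sub>v y = K\<^sup>T *\<^sub>v (E\<^sup>T *\<^sub>v y)"
    using E K y by (intro assoc_mult_mat_vec) auto
  finally have "N\<^sup>T *\<^sub>v y = 0\<^sub>v t" unfolding Dy Ey using K by auto
  then have "y \<bullet> y = 0"
    using transpose_vec_mult_scalar[OF N x y] x unfolding y_def[symmetric] by simp
  then have "y = 0\<^sub>v n" by (rule scalar_prod_self_eq_0[OF y])
  moreover have "y = D *\<^sub>v x + E *\<^sub>v ((-1) \<cdot>\<^sub>v (K *\<^sub>v x))"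
    unfolding y_def N_def using D E K x
    by (subst mult_mat_vec[OF E]) (auto simp: minus_mult_distrib_mat_vec[of _ n t] intro!: eq_vecI)
  ultimately show ?thesis using K x by (intro bexI[of _ "(-1) \<cdot>\<^sub>v (K *\<^sub>v x)"]) auto
qed

lemma rank_kernel_constants:
  fixes A :: "real mat"
  assumes A: "A \<in> carrier_mat t t" and t: "0 < t"
    and ker: "\<And>x. x \<in> carrier_vec t \<Longrightarrow> A *\<^sub>v x = 0\<^sub>v t \<Longrightarrow> \<exists>c. \<forall>a<t. x $ a = c"
    and right: "A *\<^sub>v vec t (\<lambda>_. 1) = 0\<^sub>v t" and left: "A\<^sup>T *\<^sub>v vec t (\<lambda>_. 1) = 0\<^sub>v t"
  shows "vec_space.rank t A = t - 1"
proof -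
  define u :: "real vec" where "u = vec t (\<lambda>_. 1)"
  define J :: "real mat" where "J = mat t t (\<lambda>_. 1)"
  have u: "u \<in> carrier_vec t" and J: "J \<in> carrier_mat t t" unfolding u_def J_def by auto
  have "u \<noteq> 0\<^sub>v t" using t unfolding u_def by (auto simp: vec_eq_iff)
  with u right have "det A = 0"
    using A unfolding u_def[symmetric] by (auto simp: det_0_iff_vec_prod_zero_field)
  then have "vec_space.rank t A < t"
    using vec_space.det_zero_low_rank[OF A] by blast
  moreover have "t \<le> vec_space.rank t A + 1"
  proof -
    \<comment> \<open>The all-ones matrix \<open>J\<close> has rank at most one and removes the kernel.\<close>
    have "det (A + J) \<noteq> 0"
    proof
      assume "det (A + J) = 0"
      then obtain x where x: "x \<in> carrier_vec t" "x \<noteq> 0\<^sub>v t" and 0: "(A + J) *\<^sub>v x = 0\<^sub>v t"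
        using A J by (auto simp: det_0_iff_vec_prod_zero_field[of _ t])
      have split: "A *\<^sub>v x + J *\<^sub>v x = 0\<^sub>v t"
        using 0 add_mult_distrib_mat_vec[OF A J x(1)] by simp
      have Jx: "J *\<^sub>v x = (u \<bullet> x) \<cdot>\<^sub>v u"
        unfolding J_def u_def using x by (intro eq_vecI) (auto simp: scalar_prod_def)
      \<comment> \<open>As \<open>u\<close> is a left null vector of \<open>A\<close>, pairing the
        equation with \<open>u\<close> isolates the contribution of \<open>J\<close>; thus
        \<open>A *\<^sub>v x\<close> and \<open>J *\<^sub>v x\<close> vanish separately.\<close>
      have "u \<bullet> (A *\<^sub>v x) = (A\<^sup>T *\<^sub>v u) \<bullet> x"
        using A u x by (simp add: transpose_vec_mult_scalar)
      then have "u \<bullet> (A *\<^sub>v x) = 0" using left x unfolding u_def[symmetric] by simp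
      moreover have "u \<bullet> (A *\<^sub>v x + J *\<^sub>v x) = u \<bullet> (A *\<^sub>v x) + u \<bullet> (J *\<^sub>v x)"
        using A J x u by (intro scalar_prod_add_distrib) auto
      ultimately have "u \<bullet> (J *\<^sub>v x) = 0" using split u by simp
      moreover have "u \<bullet> (J *\<^sub>v x) = (u \<bullet> x) * real t"
        unfolding Jx using u by (simp add: u_def scalar_prod_def)
      ultimately have ux: "u \<bullet> x = 0" using t by simp
      then have "J *\<^sub>v x = 0\<^sub>v t" unfolding Jx using u by auto
      then have "A *\<^sub>v x = 0\<^sub>v t" using split A x by simp
      then obtain c where c: "\<forall>a<t. x $ a = c" using ker x by blast
      then have "u \<bullet> x = real t * c" unfolding u_def using x by (simp add: scalar_prod_def)
      then have "c = 0" using ux t by simp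
      then show False using c x by (auto simp: vec_eq_iff)
    qed
    then have "t = vec_space.rank t (A + J)"
      using vec_space.det_rank_iff[of "A + J" t] A J by simp
    also have "\<dots> \<le> vec_space.rank t A + vec_space.rank t J"
      using vec_space.rank_subadditive[OF A J] .
    also have "vec_space.rank t J \<le> 1"
      by (rule vec_space.rank_le_1_product_entries[OF J, of "\<lambda>_. 1" "\<lambda>_. 1"]) (simp add: J_def)
    finally show ?thesis by simp
  qed
  ultimately show ?thesis by simp
qed

text \<open>The middle factor is arbitrary because a generalized inverse need not be symmetric: row
  sums of the information matrix use \<open>G\<close>, column sums its transpose.\<close>

lemma schur_complement_null_vector:
  fixes D E H :: "real mat"
  assumes D: "D \<in> carrier_mat n t" and E: "E \<in> carrier_mat n u" and H: "H \<in> carrier_mat u u"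
    and v: "v \<in> carrier_vec t" and 0: "D *\<^sub>v v = 0\<^sub>v n"
  shows "(D\<^sup>T * D - D\<^sup>T * E * H * (E\<^sup>T * D)) *\<^sub>v v = 0\<^sub>v t"
proof -
  have "(D\<^sup>T * D - D\<^sup>T * E * H * (E\<^sup>T * D)) *\<^sub>v v = D\<^sup>T * D *\<^sub>v v - D\<^sup>T * E * H * (E\<^sup>T * D) *\<^sub>v v"
    using D E H v by (intro minus_mult_distrib_mat_vec[of _ t t]) auto
  also have "D\<^sup>T * D *\<^sub>v v = D\<^sup>T *\<^sub>v (D *\<^sub>v v)"
    using D v by (intro assoc_mult_mat_vec) auto
  also have "D\<^sup>T * E * H * (E\<^sup>T * D) *\<^sub>v v = D\<^sup>T * E * H *\<^sub>v (E\<^sup>T * D *\<^sub>v v)"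
    using D E H v by (intro assoc_mult_mat_vec[of _ t u _ t]) auto
  also have "E\<^sup>T * D *\<^sub>v v = E\<^sup>T *\<^sub>v (D *\<^sub>v v)"
    using D E v by (intro assoc_mult_mat_vec) auto
  finally have eq: "(D\<^sup>T * D - D\<^sup>T * E * H * (E\<^sup>T * D)) *\<^sub>v v =
      D\<^sup>T *\<^sub>v 0\<^sub>v n - D\<^sup>T * E * H *\<^sub>v (E\<^sup>T *\<^sub>v 0\<^sub>v n)" unfolding 0 .
  have zero: "M *\<^sub>v 0\<^sub>v b = 0\<^sub>v a" if "M \<in> carrier_mat a b" for M :: "real mat" and a b
    using that by (intro eq_vecI) auto
  have "D\<^sup>T * E * H \<in> carrier_mat t u" "D\<^sup>T \<in> carrier_mat t n" "E\<^sup>T \<in> carrier_mat u n"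
    using D E H by auto
  then show ?thesis unfolding eq by (simp add: zero del: assoc_mult_mat)
qed

lemma schur_complement_transpose:
  fixes D E G :: "real mat"
  assumes D: "D \<in> carrier_mat n t" and E: "E \<in> carrier_mat n u" and G: "G \<in> carrier_mat u u"
  shows "(D\<^sup>T * D - D\<^sup>T * E * G * (E\<^sup>T * D))\<^sup>T = D\<^sup>T * D - D\<^sup>T * E * G\<^sup>T * (E\<^sup>T * D)"
proof -
  have "(D\<^sup>T * D - D\<^sup>T * E * G * (E\<^sup>T * D))\<^sup>T = (D\<^sup>T * D)\<^sup>T - (D\<^sup>T * E * G * (E\<^sup>T * D))\<^sup>T"
    using D E G by (intro transpose_minus[of _ t t]) auto
  also have "(D\<^sup>T * D)\<^sup>T = D\<^sup>T * D" using D by (simp add: transpose_mult[of _ t n])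
  also have "(D\<^sup>T * E * G * (E\<^sup>T * D))\<^sup>T = (E\<^sup>T * D)\<^sup>T * (D\<^sup>T * E * G)\<^sup>T"
    using D E G by (intro transpose_mult[of _ t u]) auto
  also have "(E\<^sup>T * D)\<^sup>T = D\<^sup>T * E" using D E by (simp add: transpose_mult[of _ u n])
  also have "(D\<^sup>T * E * G)\<^sup>T = G\<^sup>T * (D\<^sup>T * E)\<^sup>T"
    using D E G by (intro transpose_mult[of _ t u]) auto
  also have "(D\<^sup>T * E)\<^sup>T = E\<^sup>T * D" using D E by (simp add: transpose_mult[of _ t n])
  also have "D\<^sup>T * E * (G\<^sup>T * (E\<^sup>T * D)) = D\<^sup>T * E * G\<^sup>T * (E\<^sup>T * D)"
    using D E G by (intro assoc_mult_mat[symmetric, of _ t u _ u _ t]) auto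
  finally show ?thesis .
qed

section \<open>Projecting out subjects and periods\<close>

text \<open>A row index encodes a pair of subject and period, so sums with Kronecker structure can
  be factored.\<close>

lemma sum_div_mod:
  fixes f :: "nat \<Rightarrow> nat \<Rightarrow> real"
  shows "(\<Sum>r<s * p. f (r div p) (r mod p)) = (\<Sum>i<s. \<Sum>k<p. f i k)"
proof -
  have "(\<Sum>r<s * p. f (r div p) (r mod p)) = (\<Sum>i<s. \<Sum>r=i*p..<i*p+p. f (r div p) (r mod p))"
    by (rule sum.nat_group[symmetric])
  also have "\<dots> = (\<Sum>i<s. \<Sum>k<p. f i k)"
  proof (rule sum.cong[OF refl])
    fix i
    have "(\<Sum>r=i*p..<i*p+p. f (r div p) (r mod p)) = (\<Sum>k=0..<p. f ((k + i*p) div p) ((k + i*p) mod p))"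
      using sum.shift_bounds_nat_ivl[of "\<lambda>r. f (r div p) (r mod p)" 0 "i*p" p] by (simp add: add.commute)
    also have "\<dots> = (\<Sum>k<p. f i k)"
      by (intro sum.cong) auto
    finally show "(\<Sum>r=i*p..<i*p+p. f (r div p) (r mod p)) = (\<Sum>k<p. f i k)" .
  qed
  finally show ?thesis .
qed

text \<open>
  This is \<open>(I\<^sub>s - J\<^sub>s / s) \<otimes> (I\<^sub>p - J\<^sub>p / p)\<close>, the orthogonal projection onto the complement of the
  column spaces of \<open>X\<^sub>S\<close> and \<open>X\<^sub>P\<close>.
\<close>

definition residual_proj :: "nat \<Rightarrow> nat \<Rightarrow> real mat" where
  "residual_proj p s = mat (s * p) (s * p) (\<lambda>(r, q).
     (of_bool (r div p = q div p) - 1 / real s) * (of_bool (r mod p = q mod p) - 1 / real p))"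

lemma residual_proj_carrier [simp]: "residual_proj p s \<in> carrier_mat (s * p) (s * p)"
  by (simp add: residual_proj_def)

lemma residual_proj_transpose: "(residual_proj p s)\<^sup>T = residual_proj p s"
  by (rule eq_matI) (auto simp: residual_proj_def eq_commute)

text \<open>Multiplying out the Kronecker product yields four terms that match those of
  \<open>info_block\<close> one by one.\<close>

lemma residual_proj_index:
  assumes "r < s * p" "q < s * p"
  shows "residual_proj p s $$ (r, q) = of_bool (r = q)
     + 1 / (real p * real s) - of_bool (r div p = q div p) / real p - of_bool (r mod p = q mod p) / real s"
proof -
  have "r = q \<longleftrightarrow> r div p = q div p \<and> r mod p = q mod p"
    by (metis div_mult_mod_eq)
  then have "of_bool (r = q) = (of_bool (r div p = q div p) * of_bool (r mod p = q mod p) :: real)"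
    by simp
  then show ?thesis
    using assms by (simp add: residual_proj_def left_diff_distrib right_diff_distrib diff_divide_distrib)
qed

text \<open>Entrywise form of the idempotence of the centring matrix I - J/n.\<close>

lemma centering_idem:
  fixes a b n :: nat
  assumes "a < n" "b < n"
  shows "(\<Sum>i<n. (of_bool (a = i) - 1 / real n) * (of_bool (i = b) - 1 / real n)) =
    of_bool (a = b) - 1 / real n"
proof -
  have "(\<Sum>i<n. (of_bool (a = i) - 1 / real n) * (of_bool (i = b) - 1 / real n)) =
    (\<Sum>i<n. (if a = i then of_bool (a = b) - 1 / real n else 0)
      - (if i = b then 1 / real n else 0) + 1 / real n * (1 / real n))"
    by (intro sum.cong) (auto simp: algebra_simps)
  also have "\<dots> = of_bool (a = b) - 1 / real n"
    using assms by (simp add: sum.distrib sum_subtractf)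
  finally show ?thesis .
qed

lemma residual_proj_idem: "residual_proj p s * residual_proj p s = residual_proj p s"
proof (rule eq_matI)
  fix r q assume "r < dim_row (residual_proj p s)" "q < dim_col (residual_proj p s)"
  then have rq: "r < s * p" "q < s * p" by (simp_all add: residual_proj_def)
  then have dm: "r div p < s" "q div p < s" "r mod p < p" "q mod p < p"
    by (auto simp: less_mult_imp_div_less intro!: mod_less_divisor gr0I)
  \<comment> \<open>The summand separates into a subject factor and a period factor, each handled by
    \<open>centering_idem\<close>.\<close>
  let ?f = "\<lambda>i k. ((of_bool (r div p = i) - 1 / real s) * (of_bool (i = q div p) - 1 / real s)) *
        ((of_bool (r mod p = k) - 1 / real p) * (of_bool (k = q mod p) - 1 / real p))"
  have "(residual_proj p s * residual_proj p s) $$ (r, q) = (\<Sum>j<s * p. ?f (j div p) (j mod p))"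
    using rq by (simp add: residual_proj_def scalar_prod_def atLeast0LessThan mult_ac)
  also have "\<dots> = (\<Sum>i<s. \<Sum>k<p. ?f i k)" by (rule sum_div_mod)
  also have "\<dots> = residual_proj p s $$ (r, q)"
    unfolding sum_product[symmetric] centering_idem[OF dm(1,2)] centering_idem[OF dm(3,4)]
    using rq by (simp add: residual_proj_def)
  finally show "(residual_proj p s * residual_proj p s) $$ (r, q) = residual_proj p s $$ (r, q)" .
qed (auto simp: residual_proj_def)

text \<open>In row \<open>r\<close> the identity part of the projection isolates
  \<open>y $ r\<close>; the remaining terms depend on \<open>r\<close> only through its subject or
  its period. The overall mean is assigned to the period part \<open>A\<close>.\<close>

lemma residual_proj_kernel:
  assumes y: "y \<in> carrier_vec (s * p)" and "residual_proj p s *\<^sub>v y = 0\<^sub>v (s * p)"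
  shows "\<exists>B A. \<forall>r<s * p. y $ r = B (r div p) + A (r mod p)"
proof -
  define B where "B i = (\<Sum>q<s * p. of_bool (i = q div p) / real p * y $ q)" for i
  define A where "A k = (\<Sum>q<s * p. (of_bool (k = q mod p) / real s - 1 / (real p * real s)) * y $ q)" for k
  have "y $ r = B (r div p) + A (r mod p)" if r: "r < s * p" for r
  proof -
    have "0 = (residual_proj p s *\<^sub>v y) $ r" using assms r by simp
    also have "\<dots> = (\<Sum>q<s * p. residual_proj p s $$ (r, q) * y $ q)"
      using y r by (simp add: residual_proj_def scalar_prod_def atLeast0LessThan)
    also have "\<dots> = (\<Sum>q<s * p. (if r = q then y $ q else 0)
        - of_bool (r div p = q div p) / real p * y $ q
        - (of_bool (r mod p = q mod p) / real s - 1 / (real p * real s)) * y $ q)"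
      using r by (intro sum.cong) (simp_all add: residual_proj_index algebra_simps)
    also have "\<dots> = y $ r - B (r div p) - A (r mod p)"
      using r unfolding A_def B_def by (simp add: sum_subtractf)
    finally show ?thesis by simp
  qed
  then show ?thesis by blast
qed

lemma residual_proj_ones:
  assumes "0 < p" "0 < s"
  shows "residual_proj p s *\<^sub>v vec (s * p) (\<lambda>_. 1) = 0\<^sub>v (s * p)"
proof (rule eq_vecI)
  fix r assume "r < dim_vec (0\<^sub>v (s * p) :: real vec)"
  then have r: "r < s * p" by simp
  then have dm: "r div p < s" "r mod p < p"
    using assms by (auto simp: less_mult_imp_div_less)
  let ?f = "\<lambda>i k. (of_bool (r div p = i) - 1 / real s) * (of_bool (r mod p = k) - 1 / real p)"
  have "(residual_proj p s *\<^sub>v vec (s * p) (\<lambda>_. 1)) $ r = (\<Sum>q<s * p. ?f (q div p) (q mod p))"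
    using r by (simp add: residual_proj_def scalar_prod_def atLeast0LessThan)
  also have "\<dots> = (\<Sum>i<s. \<Sum>k<p. ?f i k)" by (rule sum_div_mod)
  also have "\<dots> = (\<Sum>i<s. of_bool (r div p = i) - 1 / real s) * (\<Sum>k<p. of_bool (r mod p = k) - 1 / real p)"
    unfolding sum_product ..
  also have "(\<Sum>i<s. of_bool (r div p = i) - 1 / real s) = 0"
    using dm assms by (simp add: sum_subtractf of_bool_def)
  finally show "(residual_proj p s *\<^sub>v vec (s * p) (\<lambda>_. 1)) $ r = 0\<^sub>v (s * p) $ r" using r by simp
qed (simp add: residual_proj_def)

lemma bilinear_index:
  fixes A B M :: "real mat"
  assumes "A \<in> carrier_mat n u" "M \<in> carrier_mat n n" "B \<in> carrier_mat n v" "i < u" "j < v"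
  shows "(A\<^sup>T * M * B) $$ (i, j) = (\<Sum>r<n. \<Sum>q<n. A $$ (r, i) * B $$ (q, j) * M $$ (r, q))"
proof -
  have "A\<^sup>T * M * B = A\<^sup>T * (M * B)" using assms by (intro assoc_mult_mat) auto
  then show ?thesis using assms
    by (simp add: scalar_prod_def atLeast0LessThan sum_distrib_left mult_ac)
qed

lemma repl_index:
  assumes "A \<in> carrier_mat (s * p) u" "a < u"
  shows "repl p s A $ a = (\<Sum>r<s * p. A $$ (r, a))"
proof -
  have "X_S p s *\<^sub>v vec s (\<lambda>_. 1) = vec (s * p) (\<lambda>_. 1)"
    by (rule eq_vecI) (auto simp: X_S_def scalar_prod_def less_mult_imp_div_less)
  moreover have "repl p s A = A\<^sup>T *\<^sub>v (X_S p s *\<^sub>v vec s (\<lambda>_. 1))"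
    unfolding repl_def using assms by (intro assoc_mult_mat_vec[of _ u "s * p" _ s]) (auto simp: X_S_def)
  ultimately show ?thesis using assms by (simp add: scalar_prod_def atLeast0LessThan)
qed

text \<open>All four terms are bilinear forms in the columns of \<open>A\<close> and
  \<open>B\<close>; their kernels are the identity, the all-ones matrix, and the indicators
  \<open>?S\<close> of equal subject and \<open>?P\<close> of equal period, which combine to the
  projection.\<close>

lemma info_block_eq:
  assumes A: "A \<in> carrier_mat (s * p) u" and B: "B \<in> carrier_mat (s * p) v"
  shows "info_block p s (A\<^sup>T * B) A B = A\<^sup>T * residual_proj p s * B"
proof (rule eq_matI)
  define n where "n = s * p"
  let ?S = "mat n n (\<lambda>(r, q). of_bool (r div p = q div p)) :: real mat"
  let ?P = "mat n n (\<lambda>(r, q). of_bool (r mod p = q mod p)) :: real mat"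
  have A': "A \<in> carrier_mat n u" and B': "B \<in> carrier_mat n v" using A B unfolding n_def by auto
  have XS: "X_S p s \<in> carrier_mat n s" and XP: "X_P p s \<in> carrier_mat n p"
    unfolding n_def X_S_def X_P_def by auto
  have "X_S p s * (X_S p s)\<^sup>T = ?S"
    by (rule eq_matI) (auto simp: X_S_def n_def scalar_prod_def less_mult_imp_div_less of_bool_def
        if_distrib[of "\<lambda>x. x * _"] cong: if_cong)
  then have S: "(A\<^sup>T * X_S p s) * ((X_S p s)\<^sup>T * B) = A\<^sup>T * ?S * B"
    using A' B' XS by (smt (verit) assoc_mult_mat mult_carrier_mat transpose_carrier_mat)
  have "X_P p s * (X_P p s)\<^sup>T = ?P"
  proof (rule eq_matI)
    fix r q assume "r < dim_row ?P" "q < dim_col ?P"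
    \<comment> \<open>A row exists only if \<open>p\<close> is positive, which puts
      \<open>r mod p\<close> in the range of the columns of \<open>X_P p s\<close>.\<close>
    moreover from this have "0 < p" by (auto simp: n_def intro!: gr0I)
    ultimately show "(X_P p s * (X_P p s)\<^sup>T) $$ (r, q) = ?P $$ (r, q)"
      by (auto simp: X_P_def n_def scalar_prod_def of_bool_def
          if_distrib[of "\<lambda>x. x * _"] cong: if_cong)
  qed (auto simp: X_P_def n_def)
  then have P: "(A\<^sup>T * X_P p s) * ((X_P p s)\<^sup>T * B) = A\<^sup>T * ?P * B"
    using A' B' XP by (smt (verit) assoc_mult_mat mult_carrier_mat transpose_carrier_mat)
  fix i j assume "i < dim_row (A\<^sup>T * residual_proj p s * B)" "j < dim_col (A\<^sup>T * residual_proj p s * B)"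
  then have ij: "i < u" "j < v" using A B by auto
  have "info_block p s (A\<^sup>T * B) A B $$ (i, j) = (A\<^sup>T * B) $$ (i, j)
     + repl p s A $ i * repl p s B $ j / (real p * real s)
     - (A\<^sup>T * ?S * B) $$ (i, j) / real p - (A\<^sup>T * ?P * B) $$ (i, j) / real s"
    unfolding info_block_def S P using A' B' ij by simp
  also have "(A\<^sup>T * B) $$ (i, j) = (\<Sum>r<n. \<Sum>q<n. A $$ (r, i) * B $$ (q, j) * of_bool (r = q))"
    using A' B' ij by (simp add: scalar_prod_def atLeast0LessThan of_bool_def
        if_distrib[of "\<lambda>x. _ * x"] cong: if_cong)
  also have "repl p s A $ i * repl p s B $ j / (real p * real s) =
     (\<Sum>r<n. \<Sum>q<n. A $$ (r, i) * B $$ (q, j) * (1 / (real p * real s)))"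
    unfolding repl_index[OF A ij(1)] repl_index[OF B ij(2)] n_def
    by (simp add: sum_product sum_divide_distrib)
  also have "(A\<^sup>T * ?S * B) $$ (i, j) / real p =
     (\<Sum>r<n. \<Sum>q<n. A $$ (r, i) * B $$ (q, j) * (of_bool (r div p = q div p) / real p))"
    by (subst bilinear_index[OF A' _ B' ij])
      (simp_all add: sum_divide_distrib del: sum_mult_of_bool_eq)
  also have "(A\<^sup>T * ?P * B) $$ (i, j) / real s =
     (\<Sum>r<n. \<Sum>q<n. A $$ (r, i) * B $$ (q, j) * (of_bool (r mod p = q mod p) / real s))"
    by (subst bilinear_index[OF A' _ B' ij])
      (simp_all add: sum_divide_distrib del: sum_mult_of_bool_eq)
  finally show "info_block p s (A\<^sup>T * B) A B $$ (i, j) = (A\<^sup>T * residual_proj p s * B) $$ (i, j)"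
    unfolding bilinear_index[OF A residual_proj_carrier B ij]
    by (simp add: residual_proj_index n_def distrib_left right_diff_distrib sum.distrib sum_subtractf)
qed (use A B in \<open>auto simp: info_block_def\<close>)

text \<open>The hypothesis \<open>rows\<close> expresses that the entries are 0 or 1 with at most
  one 1 in each row, as in \<open>X_D\<close> and \<open>X_C\<close>. Distinct columns are then
  orthogonal, and a column's squared length is its sum.\<close>

lemma repl_diag_eq:
  assumes A: "A \<in> carrier_mat (s * p) u"
    and rows: "\<And>r a b. r < s * p \<Longrightarrow> a < u \<Longrightarrow> b < u \<Longrightarrow>
      A $$ (r, a) * A $$ (r, b) = (if a = b then A $$ (r, a) else 0)"
  shows "repl_diag p s A = A\<^sup>T * A"
proof (rule eq_matI)
  fix i j assume "i < dim_row (A\<^sup>T * A)" "j < dim_col (A\<^sup>T * A)"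
  then have ij: "i < u" "j < u" using A by auto
  have "(A\<^sup>T * A) $$ (i, j) = (\<Sum>r<s * p. if i = j then A $$ (r, i) else 0)"
    using A ij rows by (simp add: scalar_prod_def atLeast0LessThan)
  then show "repl_diag p s A $$ (i, j) = (A\<^sup>T * A) $$ (i, j)"
    using A ij by (auto simp: repl_diag_def mat_diag_def repl_index)
qed (use A in \<open>auto simp: repl_diag_def mat_diag_def\<close>)

section \<open>Connectedness from the kernel\<close>

text \<open>A linear functional vanishing on the common kernel of finitely many others is a
  combination of them. Linearity is phrased through \<open>comb c x y\<close>, standing for x + c y,
  so that it applies directly to quadruples of parameter vectors.\<close>

lemma functional_combination:
  fixes f :: "nat \<Rightarrow> 'v \<Rightarrow> real" and h :: "'v \<Rightarrow> real" and comb :: "real \<Rightarrow> 'v \<Rightarrow> 'v \<Rightarrow> 'v"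
  assumes closed: "\<And>c x y. x \<in> V \<Longrightarrow> y \<in> V \<Longrightarrow> comb c x y \<in> V"
    and f: "\<And>i c x y. i < n \<Longrightarrow> x \<in> V \<Longrightarrow> y \<in> V \<Longrightarrow> f i (comb c x y) = f i x + c * f i y"
    and h: "\<And>c x y. x \<in> V \<Longrightarrow> y \<in> V \<Longrightarrow> h (comb c x y) = h x + c * h y"
    and ker: "\<And>x. x \<in> V \<Longrightarrow> (\<And>i. i < n \<Longrightarrow> f i x = 0) \<Longrightarrow> h x = 0"
  shows "\<exists>w. \<forall>x\<in>V. h x = (\<Sum>i<n. w i * f i x)"
  using f h ker
proof (induction n arbitrary: h)
  case (Suc n)
  show ?case
  \<comment> \<open>Such a \<open>z\<close> fixes the weight \<open>l\<close> of the last
    functional: \<open>h - l * f n\<close> vanishes at \<open>z\<close>, and every \<open>x\<close>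
    can be moved along \<open>z\<close> until \<open>f n\<close> vanishes. Without such a
    \<open>z\<close>, \<open>f n\<close> vanishes on the common kernel of the others and gets weight
    0.\<close>
  proof (cases "\<exists>z\<in>V. f n z \<noteq> 0 \<and> (\<forall>i<n. f i z = 0)")
    case True
    then obtain z where z: "z \<in> V" "f n z \<noteq> 0" "\<And>i. i < n \<Longrightarrow> f i z = 0" by blast
    define l where "l = h z / f n z"
    have "\<exists>w. \<forall>x\<in>V. h x - l * f n x = (\<Sum>i<n. w i * f i x)"
    proof (rule Suc.IH)
      fix x assume x: "x \<in> V" and 0: "\<And>i. i < n \<Longrightarrow> f i x = 0"
      let ?y = "comb (- (f n x / f n z)) x z"
      have "h ?y = 0"
      proof (rule Suc.prems(3))
        show "?y \<in> V" using closed x z by blast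
        show "f i ?y = 0" if "i < Suc n" for i
        proof -
          have "f i ?y = f i x - f n x / f n z * f i z" using Suc.prems(1)[OF that x z(1)] by simp
          then show ?thesis using that 0 z by (cases "i = n") auto
        qed
      qed
      moreover have "h ?y = h x - f n x / f n z * h z" using Suc.prems(2)[OF x z(1)] by simp
      ultimately show "h x - l * f n x = 0" unfolding l_def by (simp add: mult.commute)
    qed (use Suc.prems in \<open>auto simp: algebra_simps\<close>)
    then obtain w where w: "\<forall>x\<in>V. h x - l * f n x = (\<Sum>i<n. w i * f i x)" by blast
    have "h x = (\<Sum>i<Suc n. (w(n := l)) i * f i x)" if "x \<in> V" for x
    proof -
      have "(\<Sum>i<n. (w(n := l)) i * f i x) = (\<Sum>i<n. w i * f i x)" by (intro sum.cong) auto
      then show ?thesis using w that by (simp add: algebra_simps)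
    qed
    then show ?thesis by blast
  next
    case False
    have "\<exists>w. \<forall>x\<in>V. h x = (\<Sum>i<n. w i * f i x)"
    proof (rule Suc.IH)
      fix x assume x: "x \<in> V" and 0: "\<And>i. i < n \<Longrightarrow> f i x = 0"
      then have "f n x = 0" using False by blast
      then show "h x = 0" using x 0 by (intro Suc.prems(3)) (auto simp: less_Suc_eq)
    qed (use Suc.prems in auto)
    then obtain w where w: "\<forall>x\<in>V. h x = (\<Sum>i<n. w i * f i x)" by blast
    have "h x = (\<Sum>i<Suc n. (w(n := 0)) i * f i x)" if "x \<in> V" for x
    proof -
      have "(\<Sum>i<n. (w(n := 0)) i * f i x) = (\<Sum>i<n. w i * f i x)" by (intro sum.cong) auto
      then show ?thesis using w that by simp
    qed
    then show ?thesis by blast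
  qed
qed auto

context
  fixes p s t :: nat and d :: design
  assumes p: "0 < p" and s: "0 < s" and t: "0 < t"
    and crossover: "crossover_design p s t d"
begin

lemma row_period_subject:
  assumes "r < s * p"
  shows "r mod p + 1 \<in> {1..p}" "r div p + 1 \<in> {1..s}" "r mod p \<noteq> 0 \<Longrightarrow> r mod p \<in> {1..p}"
  using assms p by (auto simp: less_mult_imp_div_less Suc_le_eq less_imp_le)

lemma design_less: "k \<in> {1..p} \<Longrightarrow> i \<in> {1..s} \<Longrightarrow> d k i < t"
  using crossover unfolding crossover_design_def by blast

lemma X_D_carrier: "X_D p s t d \<in> carrier_mat (s * p) t"
  and X_C_carrier: "X_C p s t d \<in> carrier_mat (s * p) t"
  by (simp_all add: X_D_def X_C_def)

lemma X_D_mult: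
  assumes "r < s * p" "\<tau> \<in> carrier_vec t"
  shows "(X_D p s t d *\<^sub>v \<tau>) $ r = \<tau> $ d (r mod p + 1) (r div p + 1)"
  using assms design_less[OF row_period_subject(1,2)[OF assms(1)]]
  by (simp add: X_D_def scalar_prod_def if_distrib[of "\<lambda>x. x * _"] cong: if_cong)

lemma X_C_mult:
  assumes "r < s * p" "\<rho> \<in> carrier_vec t"
  shows "(X_C p s t d *\<^sub>v \<rho>) $ r = (if r mod p = 0 then 0 else \<rho> $ d (r mod p) (r div p + 1))"
  using assms design_less[OF row_period_subject(3)[OF assms(1)] row_period_subject(2)[OF assms(1)]]
  by (auto simp: X_C_def scalar_prod_def if_distrib[of "\<lambda>x. x * _"] cong: if_cong)

lemma mean_response_index:
  assumes r: "r < s * p" and v: "\<beta> \<in> carrier_vec s" "\<alpha> \<in> carrier_vec p" "\<tau> \<in> carrier_vec t" "\<rho> \<in> carrier_vec t"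
  shows "mean_response p s t d \<beta> \<alpha> \<tau> \<rho> $ r = \<beta> $ (r div p) + \<alpha> $ (r mod p)
    + \<tau> $ d (r mod p + 1) (r div p + 1) + (if r mod p = 0 then 0 else \<rho> $ d (r mod p) (r div p + 1))"
proof -
  have "(X_S p s *\<^sub>v \<beta>) $ r = \<beta> $ (r div p)"
    using r v by (simp add: X_S_def scalar_prod_def less_mult_imp_div_less if_distrib[of "\<lambda>x. x * _"] cong: if_cong)
  moreover have "(X_P p s *\<^sub>v \<alpha>) $ r = \<alpha> $ (r mod p)"
    using r v p by (simp add: X_P_def scalar_prod_def if_distrib[of "\<lambda>x. x * _"] cong: if_cong)
  ultimately show ?thesis
    using r X_D_mult[OF r v(3)] X_C_mult[OF r v(4)]
    by (simp add: mean_response_def X_D_def X_C_def X_S_def X_P_def)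
qed

text \<open>The projection is symmetric and idempotent, so it can be split between the two factors;
  this exhibits the blocks as Gram blocks of the projected matrices.\<close>

lemma C11_eq: "C11 p s t d = (residual_proj p s * X_D p s t d)\<^sup>T * (residual_proj p s * X_D p s t d)"
  and C22_eq: "C22 p s t d = (residual_proj p s * X_C p s t d)\<^sup>T * (residual_proj p s * X_C p s t d)"
  and C12_eq: "C12 p s t d = (residual_proj p s * X_D p s t d)\<^sup>T * (residual_proj p s * X_C p s t d)"
proof -
  have block: "A\<^sup>T * residual_proj p s * B = (residual_proj p s * A)\<^sup>T * (residual_proj p s * B)"
    if A: "A \<in> carrier_mat (s * p) t" and B: "B \<in> carrier_mat (s * p) t" for A B :: "real mat"
  proof -
    let ?Q = "residual_proj p s"
    have "(?Q * A)\<^sup>T * (?Q * B) = A\<^sup>T * ?Q * (?Q * B)"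
      unfolding transpose_mult[OF residual_proj_carrier A] residual_proj_transpose ..
    also have "\<dots> = A\<^sup>T * ?Q * ?Q * B"
      using A B by (intro assoc_mult_mat[symmetric, of _ t "s * p" _ "s * p" _ t]) auto
    also have "A\<^sup>T * ?Q * ?Q = A\<^sup>T * (?Q * ?Q)"
      using A by (intro assoc_mult_mat[of _ t "s * p" _ "s * p" _ "s * p"]) auto
    finally show ?thesis unfolding residual_proj_idem ..
  qed
  note carriers = X_D_carrier X_C_carrier
  have "repl_diag p s (X_D p s t d) = (X_D p s t d)\<^sup>T * X_D p s t d"
    by (rule repl_diag_eq[OF X_D_carrier]) (simp add: X_D_def)
  then show "C11 p s t d = (residual_proj p s * X_D p s t d)\<^sup>T * (residual_proj p s * X_D p s t d)"
    using info_block_eq[OF carriers(1,1)] block[OF carriers(1,1)] by (simp add: C11_def)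
  have "repl_diag p s (X_C p s t d) = (X_C p s t d)\<^sup>T * X_C p s t d"
    by (rule repl_diag_eq[OF X_C_carrier]) (simp add: X_C_def)
  then show "C22 p s t d = (residual_proj p s * X_C p s t d)\<^sup>T * (residual_proj p s * X_C p s t d)"
    using info_block_eq[OF carriers(2,2)] block[OF carriers(2,2)] by (simp add: C22_def)
  show "C12 p s t d = (residual_proj p s * X_D p s t d)\<^sup>T * (residual_proj p s * X_C p s t d)"
    using info_block_eq[OF carriers] block[OF carriers] by (simp add: C12_def)
qed

text \<open>Estimability comes from writing the contrast as a combination of the rows of the mean
  response, the rank from lifting null vectors of the information matrix to parameter vectors with
  zero mean response.\<close>

lemma connected_direct_if_kernel:
  assumes ker: "\<And>\<beta> \<alpha> \<tau> \<rho> :: nat \<Rightarrow> real.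
    (\<And>k i. k \<in> {1..p} \<Longrightarrow> i \<in> {1..s} \<Longrightarrow>
      \<beta> i + \<alpha> k + \<tau> (d k i) + (if k = 1 then 0 else \<rho> (d (k-1) i)) = 0) \<Longrightarrow> \<exists>c. \<forall>a<t. \<tau> a = c"
  shows "connected_direct p s t d"
proof -
  \<comment> \<open>This restates the hypothesis by matrix rows, where subjects and periods count
    from 0; hence the shifts by one.\<close>
  have rows: "\<exists>c. \<forall>a<t. \<tau> a = c"
    if eq: "\<And>r. r < s * p \<Longrightarrow> \<beta> (r div p) + \<alpha> (r mod p) + \<tau> (d (r mod p + 1) (r div p + 1))
      + (if r mod p = 0 then 0 else \<rho> (d (r mod p) (r div p + 1))) = 0"
    for \<beta> \<alpha> \<tau> \<rho> :: "nat \<Rightarrow> real"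
  proof (rule ker)
    fix k i assume ki: "k \<in> {1..p}" "i \<in> {1..s}"
    define k' where "k' = k - 1"
    define r where "r = (i - 1) * p + k'"
    have k': "k' < p" "k = k' + 1" using ki unfolding k'_def by auto
    have r: "r div p = i - 1" "r mod p = k - 1" using k' unfolding r_def by auto
    have "r < (i - 1) * p + p" using k' unfolding r_def by auto
    also have "\<dots> = i * p" using ki by (cases i) auto
    also have "\<dots> \<le> s * p" using ki by simp
    finally have "r < s * p" .
    from eq[OF this] show "\<beta> (i - 1) + \<alpha> (k - 1) + \<tau> (d k i) + (if k = 1 then 0 else \<rho> (d (k-1) i)) = 0"
      unfolding r using ki by (auto split: if_splits)
  qed
  have "contrast_estimable p s t d i j" if ij: "i < t" "j < t" for i j
  proof -
    define V where "V = (carrier_vec s :: real vec set) \<times> (carrier_vec p :: real vec set)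
      \<times> (carrier_vec t :: real vec set) \<times> (carrier_vec t :: real vec set)"
    define f where "f r = (\<lambda>(\<beta>, \<alpha>, \<tau>, \<rho>). mean_response p s t d \<beta> \<alpha> \<tau> \<rho> $ r)" for r
    define h where "h = (\<lambda>(\<beta> :: real vec, \<alpha> :: real vec, \<tau> :: real vec, \<rho> :: real vec). \<tau> $ i - \<tau> $ j)"
    define comb where "comb c = (\<lambda>(\<beta> :: real vec, \<alpha> :: real vec, \<tau> :: real vec, \<rho> :: real vec) (\<beta>', \<alpha>', \<tau>', \<rho>').
      (\<beta> + c \<cdot>\<^sub>v \<beta>', \<alpha> + c \<cdot>\<^sub>v \<alpha>', \<tau> + c \<cdot>\<^sub>v \<tau>', \<rho> + c \<cdot>\<^sub>v \<rho>'))" for c :: real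
    \<comment> \<open>The weights \<open>w\<close> are the coefficients of the linear unbiased
      estimator.\<close>
    have "\<exists>w. \<forall>x\<in>V. h x = (\<Sum>r<s * p. w r * f r x)"
    proof (rule functional_combination[where comb = comb])
      show "comb c x y \<in> V" if "x \<in> V" "y \<in> V" for c x y
        using that unfolding V_def comb_def by auto
      show "h (comb c x y) = h x + c * h y" if "x \<in> V" "y \<in> V" for c x y
        using that ij unfolding V_def comb_def h_def by (auto simp: algebra_simps)
      show "f r (comb c x y) = f r x + c * f r y" if r: "r < s * p" and "x \<in> V" "y \<in> V" for r c x y
      proof -
        have "r div p < s" "r mod p < p" using r p by (auto simp: less_mult_imp_div_less)
        then show ?thesis
          using that design_less[OF row_period_subject(1,2)[OF r]] design_less[OF row_period_subject(3)[OF r] row_period_subject(2)[OF r]]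
          unfolding V_def comb_def f_def by (auto simp: mean_response_index algebra_simps)
      qed
      fix x assume "x \<in> V" and 0: "\<And>r. r < s * p \<Longrightarrow> f r x = 0"
      then obtain \<beta> \<alpha> \<tau> \<rho> where x: "x = (\<beta>, \<alpha>, \<tau>, \<rho>)"
        and v: "\<beta> \<in> carrier_vec s" "\<alpha> \<in> carrier_vec p" "\<tau> \<in> carrier_vec t" "\<rho> \<in> carrier_vec t"
        unfolding V_def by auto
      have "\<exists>c. \<forall>a<t. \<tau> $ a = c"
        by (rule rows[of "($) \<beta>" "($) \<alpha>" _ "($) \<rho>"])
           (use 0 mean_response_index[OF _ v] in \<open>simp add: f_def x\<close>)
      then show "h x = 0" using ij unfolding h_def x by auto
    qed
    then obtain w where w: "\<And>x. x \<in> V \<Longrightarrow> h x = (\<Sum>r<s * p. w r * f r x)" by blast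
    show ?thesis unfolding contrast_estimable_def
    proof (intro bexI[of _ "vec (s * p) w"] ballI)
      fix \<beta> \<alpha> \<tau> \<rho> :: "real vec"
      assume "\<beta> \<in> carrier_vec s" "\<alpha> \<in> carrier_vec p" "\<tau> \<in> carrier_vec t" "\<rho> \<in> carrier_vec t"
      then have "(\<beta>, \<alpha>, \<tau>, \<rho>) \<in> V" unfolding V_def by simp
      moreover have "dim_vec (mean_response p s t d \<beta> \<alpha> \<tau> \<rho>) = s * p"
        unfolding mean_response_def by (simp add: X_C_def)
      ultimately show "vec (s * p) w \<bullet> mean_response p s t d \<beta> \<alpha> \<tau> \<rho> = \<tau> $ i - \<tau> $ j"
        using w[of "(\<beta>, \<alpha>, \<tau>, \<rho>)"] by (simp add: h_def f_def scalar_prod_def atLeast0LessThan)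
    qed simp
  qed
  moreover have "vec_space.rank t (C_D p s t d G) = t - 1" if gi: "generalized_inverse (C22 p s t d) G" for G
  proof -
    define Q where "Q = residual_proj p s"
    define D where "D = Q * X_D p s t d"
    define E where "E = Q * X_C p s t d"
    have Q: "Q \<in> carrier_mat (s * p) (s * p)" unfolding Q_def by simp
    have D: "D \<in> carrier_mat (s * p) t" and E: "E \<in> carrier_mat (s * p) t"
      unfolding D_def E_def using Q X_D_carrier X_C_carrier by auto
    have C22: "C22 p s t d = E\<^sup>T * E" unfolding C22_eq D_def E_def Q_def ..
    have G: "G \<in> carrier_mat t t" and gi': "(E\<^sup>T * E) * G * (E\<^sup>T * E) = E\<^sup>T * E"
      using gi E unfolding generalized_inverse_def C22 by auto
    have C21: "C21 p s t d = E\<^sup>T * D"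
      unfolding C21_def C12_eq using D E
      by (simp add: transpose_mult[of _ t "s * p"] flip: Q_def D_def E_def)
    have CD: "C_D p s t d G = D\<^sup>T * D - D\<^sup>T * E * G * (E\<^sup>T * D)"
      unfolding C_D_def C11_eq C12_eq C21 by (simp flip: Q_def D_def E_def)
    have ones: "vec t (\<lambda>_. 1) \<in> carrier_vec t" by simp
    \<comment> \<open>Each row of \<open>X_D\<close> has exactly one 1, so the constant vector is
      mapped to a constant one, which the projection annihilates.\<close>
    have "X_D p s t d *\<^sub>v vec t (\<lambda>_. 1) = vec (s * p) (\<lambda>_. 1)"
    proof (rule eq_vecI)
      fix r assume "r < dim_vec (vec (s * p) (\<lambda>_. 1 :: real))"
      then have r: "r < s * p" by simp
      show "(X_D p s t d *\<^sub>v vec t (\<lambda>_. 1)) $ r = vec (s * p) (\<lambda>_. 1) $ r"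
        using X_D_mult[OF r ones] design_less[OF row_period_subject(1,2)[OF r]] r by simp
    qed (simp add: X_D_def)
    then have D1: "D *\<^sub>v vec t (\<lambda>_. 1) = 0\<^sub>v (s * p)"
      unfolding D_def assoc_mult_mat_vec[OF Q X_D_carrier ones] unfolding Q_def
      using residual_proj_ones[OF p s] by simp
    show ?thesis unfolding CD
    proof (rule rank_kernel_constants[OF _ t])
      show "D\<^sup>T * D - D\<^sup>T * E * G * (E\<^sup>T * D) \<in> carrier_mat t t" using D E G by auto
      show "(D\<^sup>T * D - D\<^sup>T * E * G * (E\<^sup>T * D)) *\<^sub>v vec t (\<lambda>_. 1) = 0\<^sub>v t"
        by (rule schur_complement_null_vector[OF D E G ones D1])
      show "(D\<^sup>T * D - D\<^sup>T * E * G * (E\<^sup>T * D))\<^sup>T *\<^sub>v vec t (\<lambda>_. 1) = 0\<^sub>v t"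
        unfolding schur_complement_transpose[OF D E G]
        by (rule schur_complement_null_vector[OF D E _ ones D1]) (use G in simp)
      fix x assume x: "x \<in> carrier_vec t" and "(D\<^sup>T * D - D\<^sup>T * E * G * (E\<^sup>T * D)) *\<^sub>v x = 0\<^sub>v t"
      then obtain z where z: "z \<in> carrier_vec t" and 0: "D *\<^sub>v x + E *\<^sub>v z = 0\<^sub>v (s * p)"
        using schur_complement_kernel[OF D E G gi'] by blast
      \<comment> \<open>The projection of \<open>y\<close> vanishes, so \<open>y\<close> is a sum of
        a subject part and a period part; their negatives complete \<open>x\<close> and
        \<open>z\<close> to a parameter vector with zero mean response.\<close>
      define y where "y = X_D p s t d *\<^sub>v x + X_C p s t d *\<^sub>v z"
      have XDx: "X_D p s t d *\<^sub>v x \<in> carrier_vec (s * p)" and XCz: "X_C p s t d *\<^sub>v z \<in> carrier_vec (s * p)"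
        using X_D_carrier X_C_carrier x z by auto
      have "Q *\<^sub>v y = D *\<^sub>v x + E *\<^sub>v z"
        unfolding y_def D_def E_def mult_add_distrib_mat_vec[OF Q XDx XCz]
        using Q X_D_carrier X_C_carrier x z by simp
      then have "residual_proj p s *\<^sub>v y = 0\<^sub>v (s * p)" using 0 unfolding Q_def by simp
      then obtain B A where BA: "\<forall>r<s * p. y $ r = B (r div p) + A (r mod p)"
        using residual_proj_kernel[of y s p] XDx XCz unfolding y_def by auto
      show "\<exists>c. \<forall>a<t. x $ a = c"
      proof (rule rows[of "\<lambda>i. - B i" "\<lambda>k. - A k" _ "($) z"])
        fix r assume r: "r < s * p"
        then have "y $ r = (X_D p s t d *\<^sub>v x) $ r + (X_C p s t d *\<^sub>v z) $ r"
          unfolding y_def by (simp add: X_C_def)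
        then show "- B (r div p) + - A (r mod p) + x $ d (r mod p + 1) (r div p + 1)
          + (if r mod p = 0 then 0 else z $ d (r mod p) (r div p + 1)) = 0"
          using BA r unfolding X_D_mult[OF r x] X_C_mult[OF r z] by simp
      qed
    qed
  qed
  ultimately show ?thesis unfolding connected_direct_def by blast
qed

end

section \<open>Connectedness of truncated designs\<close>

lemma connected_direct_truncated:
  assumes d: "ubrmd g t d" and g: "1 \<le> g" and t: "t = p + m" "2 \<le> t" and p: "1 \<le> p"
    and definite: "\<And>x y. 0 \<le> x \<Longrightarrow> 0 \<le> y \<Longrightarrow>
      real p * x\<^sup>2 + (real p - 1) * y\<^sup>2 - 2 * (real m + 1) * x * y
        \<le> (real m * x + (real m + 1) * y)\<^sup>2 / real p \<Longrightarrow> x = 0"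
  shows "connected_direct p (g * t) t d"
proof (rule connected_direct_if_kernel)
  show "crossover_design p (g * t) t d"
    using d t unfolding ubrmd_def crossover_design_def by auto
  show "\<exists>c. \<forall>a<t. \<tau> a = c"
    if "\<And>k i. k \<in> {1..p} \<Longrightarrow> i \<in> {1..g * t} \<Longrightarrow>
      \<beta> i + \<alpha> k + \<tau> (d k i) + (if k = 1 then 0 else \<rho> (d (k-1) i)) = 0"
    for \<beta> \<alpha> \<tau> \<rho> :: "nat \<Rightarrow> real"
    using d g t p definite that by (rule kernel_direct_effects_constant)
qed (use g t p in auto)

theorem corollary7:
  shows "(\<forall>m::nat. 1 \<le> m \<longrightarrow>
            (\<exists>tstar::nat. 0 < tstar \<and>
               (\<forall>t g d. tstar \<le> t \<and> m < t - 1 \<and> 1 \<le> g \<and> ubrmd g t d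
                  \<longrightarrow> connected_direct (t - m) (g * t) t d)))
       \<and> (\<forall>t g d. 5 \<le> t \<and> 1 \<le> g \<and> ubrmd g t d \<longrightarrow> connected_direct (t - 1) (g * t) t d)
       \<and> (\<forall>t g d. 8 \<le> t \<and> 1 \<le> g \<and> ubrmd g t d \<longrightarrow> connected_direct (t - 2) (g * t) t d)"
proof (intro conjI allI impI)
  fix m :: nat
  \<comment> \<open>The threshold is \<open>4 * m + 3 = m + 3 * (m + 1)\<close>, so at least
    \<open>3 * (m + 1)\<close> periods remain.\<close>
  have "connected_direct (t - m) (g * t) t d"
    if "4 * m + 3 \<le> t" "1 \<le> g" "ubrmd g t d" for t g d
  proof (rule connected_direct_truncated[OF that(3,2)])
    fix x y :: real assume xy: "0 \<le> x" "0 \<le> y"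
      and le: "real (t - m) * x\<^sup>2 + (real (t - m) - 1) * y\<^sup>2 - 2 * (real m + 1) * x * y
        \<le> (real m * x + (real m + 1) * y)\<^sup>2 / real (t - m)"
    have "3 * (real m + 1) \<le> real (t - m)" using that(1) by (simp add: of_nat_diff)
    then show "x = 0"
      by (intro definite_general[of "real m", OF _ xy definite_mono[OF _ _ le]]) auto
  qed (use that in auto)
  then show "\<exists>tstar::nat. 0 < tstar \<and> (\<forall>t g d. tstar \<le> t \<and> m < t - 1 \<and> 1 \<le> g \<and> ubrmd g t d
      \<longrightarrow> connected_direct (t - m) (g * t) t d)"
    by (intro exI[of _ "4 * m + 3"]) auto
next
  fix t g :: nat and d assume *: "5 \<le> t \<and> 1 \<le> g \<and> ubrmd g t d"
  show "connected_direct (t - 1) (g * t) t d"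
  \<comment> \<open>At least 4 periods remain, the case of \<open>definite_1\<close>.\<close>
  proof (rule connected_direct_truncated[where m = 1])
    fix x y :: real
    assume "real (t - 1) * x\<^sup>2 + (real (t - 1) - 1) * y\<^sup>2 - 2 * (real 1 + 1) * x * y
        \<le> (real 1 * x + (real 1 + 1) * y)\<^sup>2 / real (t - 1)"
    then show "x = 0"
      using * definite_mono[of 4 "real (t - 1)" x y 1] by (intro definite_1) (simp add: of_nat_diff)
  qed (use * in auto)
next
  fix t g :: nat and d assume *: "8 \<le> t \<and> 1 \<le> g \<and> ubrmd g t d"
  show "connected_direct (t - 2) (g * t) t d"
  \<comment> \<open>At least 6 periods remain, the case of \<open>definite_2\<close>.\<close>
  proof (rule connected_direct_truncated[where m = 2])
    fix x y :: real
    assume "real (t - 2) * x\<^sup>2 + (real (t - 2) - 1) * y\<^sup>2 - 2 * (real 2 + 1) * x * y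
        \<le> (real 2 * x + (real 2 + 1) * y)\<^sup>2 / real (t - 2)"
    then show "x = 0"
      using * definite_mono[of 6 "real (t - 2)" x y 2] by (intro definite_2) (simp add: of_nat_diff)
  qed (use * in auto)
qed

end
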